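(* Let $G$ be a finitely generated hyperbolic group, with word metric taken with respect to a fixed finite generating set, and let $A\subseteq G$ be an infinite approximate semigroup. Then either (1) $A$ has positive exponential growth in $G$, or (2) the subgroup $\langle A\rangle$ generated by $A$ is virtually cyclic.
   Context: For a finitely generated group $G$ with a fixed finite generating set, $B_n$ denotes the ball of radius $n$ around the identity in the corresponding word metric. A subset $A\subseteq G$ is an approximate semigroup if there is a finite subset $X\subseteq G$ such that $A^2\subseteq AX$, where $A^2=AA=\{ab:a,b\in A\}$ and $AX=\{ax: a\in A,x\in X\}$. The set $A$ has positive exponential growth in $G$ if $\liminf_{n\to\infty}\frac1n\log|A\cap B_n|>0$ (equivalently, there are $C>0$ and $\lambda>1$ with $|A\cap B_n|\ge C\lambda^n$ for all sufficiently large $n$). *)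

theory Defs
  imports "HOL-Algebra.Algebra" "HOL-Library.Extended_Real"
begin

definition finite_generating_set :: "('a, 'b) monoid_scheme \<Rightarrow> 'a set \<Rightarrow> bool" where
  "finite_generating_set G S \<longleftrightarrow>
     finite S \<and> S \<subseteq> carrier G \<and> generate G S = carrier G"

(* S need not be symmetric: the words use letters from S and their inverses.
   The value is meaningful only for elements of the subgroup generated by S. *)
definition word_length :: "('a, 'b) monoid_scheme \<Rightarrow> 'a set \<Rightarrow> 'a \<Rightarrow> nat" where
  "word_length G S g =
     (LEAST n. \<exists>w. length w = n \<and> set w \<subseteq> S \<union> m_inv G ` S \<and> foldr (\<otimes>\<^bsub>G\<^esub>) w \<one>\<^bsub>G\<^esub> = g)"

definition word_dist :: "('a, 'b) monoid_scheme \<Rightarrow> 'a set \<Rightarrow> 'a \<Rightarrow> 'a \<Rightarrow> real" where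
  "word_dist G S x y = real (word_length G S (inv\<^bsub>G\<^esub> x \<otimes>\<^bsub>G\<^esub> y))"

definition word_ball :: "('a, 'b) monoid_scheme \<Rightarrow> 'a set \<Rightarrow> nat \<Rightarrow> 'a set" where
  "word_ball G S n = {g \<in> carrier G. word_dist G S \<one>\<^bsub>G\<^esub> g \<le> real n}"

definition gromov_product :: "('a \<Rightarrow> 'a \<Rightarrow> real) \<Rightarrow> 'a \<Rightarrow> 'a \<Rightarrow> 'a \<Rightarrow> real" where
  "gromov_product d e x y = (d e x + d e y - d x y) / 2"

(* Gromov's four-point condition; it makes sense in any metric space, so it is applied
   directly to the group with its word metric, with no passage to the Cayley graph. *)
definition gromov_hyperbolic :: "'a set \<Rightarrow> ('a \<Rightarrow> 'a \<Rightarrow> real) \<Rightarrow> bool" where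
  "gromov_hyperbolic M d \<longleftrightarrow>
     (\<exists>\<delta>\<ge>0. \<forall>e\<in>M. \<forall>x\<in>M. \<forall>y\<in>M. \<forall>z\<in>M.
        gromov_product d e x z \<ge> min (gromov_product d e x y) (gromov_product d e y z) - \<delta>)"

definition hyperbolic_group :: "('a, 'b) monoid_scheme \<Rightarrow> bool" where
  "hyperbolic_group G \<longleftrightarrow>
     group G \<and>
     (\<exists>S. finite_generating_set G S \<and> gromov_hyperbolic (carrier G) (word_dist G S))"

definition approximate_semigroup :: "('a, 'b) monoid_scheme \<Rightarrow> 'a set \<Rightarrow> bool" where
  "approximate_semigroup G A \<longleftrightarrow>
     A \<subseteq> carrier G \<and> (\<exists>F. finite F \<and> F \<subseteq> carrier G \<and> A <#>\<^bsub>G\<^esub> A \<subseteq> A <#>\<^bsub>G\<^esub> F)"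

(* The convention ln 0 = 0 does not matter: if A is nonempty, it meets all large balls,
   and if A is empty, the lower limit is 0 instead of -\<infinity>, hence still not positive. *)
definition positive_exponential_growth ::
    "('a, 'b) monoid_scheme \<Rightarrow> 'a set \<Rightarrow> 'a set \<Rightarrow> bool" where
  "positive_exponential_growth G S A \<longleftrightarrow>
     liminf (\<lambda>n. ereal (1 / real n * ln (real (card (A \<inter> word_ball G S n))))) > 0"

(* Cyclic subgroups may be finite, so every finite group is virtually cyclic. *)
definition virtually_cyclic :: "('a, 'b) monoid_scheme \<Rightarrow> bool" where
  "virtually_cyclic G \<longleftrightarrow>
     (\<exists>C. subgroup C G \<and> cyclic_group (G\<lparr>carrier := C\<rparr>) \<and> finite (rcosets\<^bsub>G\<^esub> C))"

end

theory Submission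
  imports Defs
begin

text \<open>
  Write |x| for a word length in which the four-point condition holds and (x|y) for the Gromov
  product with base point the identity, so that |xy| = |x| + |y| - 2 (x^-1|y).

  If F witnesses that A is an approximate semigroup, left multiplication by an element of A moves
  A F^i into A F^(i+1). The elements y of the subgroup generated by A for which some constant k
  satisfies y (A F^i) \<subseteq> A F^(i+k) for all i therefore form a subsemigroup P containing A. Suppose
  that for one fixed k there are arbitrarily large finite sets Y of such elements whose words of
  equal length have different products. Applied to one element of A, the |Y|^m words of length m
  give elements of A F^(mk), each within distance linear in m of A, and at most |F|^(mk) of these
  elements come from the same element of A.
  Taking |Y| = 2 |F|^k leaves at least 2^m elements of A in a ball of radius linear in m: the growth
  is exponential. What has to be found is such sets Y, with k independent of |Y|.

  An infinite subsemigroup of a group with such a length contains a loxodromic element f, in the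
  strong sense that |ff| exceeds |f| by more than three times the hyperbolicity constant
  (\<open>exists_loxodromic\<close>): otherwise every element of the semigroup nearly fixes the midpoint
  of its own geodesic, these geodesics all run along one ray, and arbitrarily many elements move a
  single far point on it by a bounded amount, which the finiteness of balls forbids.

  The elements h with h f^p = f^q h for some p, q > 0 form a subgroup H, the stabilizer of the
  forward end of the axis of f. It is a finite union of cosets of the group generated by f, and for
  h outside H the sequences f^n and h f^n diverge (\<open>fellow_imp_end_stab\<close>,
  \<open>end_stab_finite_cosets\<close>). If P meets only finitely many cosets of H, the subgroup
  generated by P permutes them and is virtually cyclic
  (\<open>virtually_cyclic_of_finite_orbit\<close>). Otherwise there are u1, u2, u3 in P in
  different left cosets of H and v1, v2 in P in different right cosets. The elements u f^n v, for
  large n, are connectors: a given direction can agree for long with the beginning of u f^n v for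
  at most one of the three u, and with the beginning of its inverse for at most one of the two v.

  So one v serves infinitely many a in A, and for each of these one can choose u such that the path
  a (u f^n v) turns away from a^-1, and also from infinitely many of the longer elements of A.
  Selecting the a's one after the other in this way (\<open>separated_products\<close>) gives sets Y
  of elements a (u f^n v) of any finite size; their words of equal length have different products
  because such products follow quasi-geodesics (\<open>free_onI\<close>), and only the three connectors
  matter for k.
\<close>

section \<open>Lengths with the four-point condition\<close>

context group
begin

lemma mult_inv_cancel_left: "x \<in> carrier G \<Longrightarrow> y \<in> carrier G \<Longrightarrow> x \<otimes> (inv x \<otimes> y) = y"
  by (simp add: m_assoc[symmetric])

lemma inv_mult_cancel_left: "x \<in> carrier G \<Longrightarrow> y \<in> carrier G \<Longrightarrow> inv x \<otimes> (x \<otimes> y) = y"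
  by (simp add: m_assoc[symmetric])

lemmas group_norm = m_assoc inv_mult_group mult_inv_cancel_left inv_mult_cancel_left

lemma pow_Suc_left: "x \<in> carrier G \<Longrightarrow> x [^] Suc n = x \<otimes> x [^] (n::nat)"
  by (metis nat_pow_Suc2)

lemma inv_pow_Suc: "x \<in> carrier G \<Longrightarrow> inv (x [^] Suc n) = inv x \<otimes> inv (x [^] (n::nat))"
  by (simp add: inv_mult_group)

end

text \<open>
  The word metric seen from the identity: left invariance reduces distances to lengths of
  quotients, and the four-point condition is only recorded at the base point \<open>\<one>\<close>.
  The prefixes play the role of points on a geodesic from \<open>\<one>\<close> to x.
\<close>

locale hyperbolic_length = group G for G (structure) +
  fixes len :: "'a \<Rightarrow> real" and \<delta> :: real
  assumes delta_nonneg: "0 \<le> \<delta>"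
    and len_one [simp]: "len \<one> = 0"
    and len_inv [simp]: "x \<in> carrier G \<Longrightarrow> len (inv x) = len x"
    and len_mult: "x \<in> carrier G \<Longrightarrow> y \<in> carrier G \<Longrightarrow> len (x \<otimes> y) \<le> len x + len y"
    and finite_ball: "finite {x \<in> carrier G. len x \<le> r}"
    and geodesic_prefix: "x \<in> carrier G \<Longrightarrow> 0 \<le> r \<Longrightarrow> r \<le> len x \<Longrightarrow>
      \<exists>p\<in>carrier G. len p + len (inv p \<otimes> x) = len x \<and> len p \<le> r \<and> r < len p + 1"
    and four_point: "x \<in> carrier G \<Longrightarrow> y \<in> carrier G \<Longrightarrow> z \<in> carrier G \<Longrightarrow>
      min ((len x + len y - len (inv x \<otimes> y)) / 2) ((len y + len z - len (inv y \<otimes> z)) / 2) - \<delta>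
        \<le> (len x + len z - len (inv x \<otimes> z)) / 2"
begin

text \<open>
  The Gromov product with base point \<open>\<one>\<close>.
\<close>

definition gp :: "'a \<Rightarrow> 'a \<Rightarrow> real" where
  "gp x y = (len x + len y - len (inv x \<otimes> y)) / 2"

lemma len_nonneg: "x \<in> carrier G \<Longrightarrow> 0 \<le> len x"
  using len_mult[of x "inv x"] by simp

lemma gp_sym: "x \<in> carrier G \<Longrightarrow> y \<in> carrier G \<Longrightarrow> gp x y = gp y x"
  using len_inv[of "inv x \<otimes> y"] by (simp add: gp_def inv_mult_group)

lemma gp_nonneg: "x \<in> carrier G \<Longrightarrow> y \<in> carrier G \<Longrightarrow> 0 \<le> gp x y"
  using len_mult[of "inv x" y] by (simp add: gp_def)

lemma gp_le_left: "x \<in> carrier G \<Longrightarrow> y \<in> carrier G \<Longrightarrow> gp x y \<le> len x"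
  using len_mult[of x "inv x \<otimes> y"] by (simp add: gp_def group_norm)

lemma gp_le_right: "x \<in> carrier G \<Longrightarrow> y \<in> carrier G \<Longrightarrow> gp x y \<le> len y"
  using gp_le_left gp_sym by metis

lemma gp_one [simp]: "x \<in> carrier G \<Longrightarrow> gp x \<one> = 0" "x \<in> carrier G \<Longrightarrow> gp \<one> x = 0"
  by (simp_all add: gp_def)

lemma gp_hyp: "x \<in> carrier G \<Longrightarrow> y \<in> carrier G \<Longrightarrow> z \<in> carrier G \<Longrightarrow> min (gp x y) (gp y z) - \<delta> \<le> gp x z"
  using four_point by (simp add: gp_def)

text \<open>
  If y and z agree for longer than x and y do, then x leaves z where it leaves y.
  Nearly all later estimates chain this step.
\<close>

lemma gp_transfer:
  assumes "x \<in> carrier G" "y \<in> carrier G" "z \<in> carrier G"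
    and "gp x y \<le> c" "c + \<delta> < gp y z"
  shows "gp x z \<le> c + \<delta>"
  using gp_hyp[of x z y] gp_sym[of y z] assms by simp

lemma gp_double: "2 * gp x y = len x + len y - len (inv x \<otimes> y)"
  by (simp add: gp_def)

lemma len_diff_gp: "x \<in> carrier G \<Longrightarrow> y \<in> carrier G \<Longrightarrow> len (inv x \<otimes> y) = len x + len y - 2 * gp x y"
  using gp_double[of x y] by linarith

lemma len_mult_gp: "x \<in> carrier G \<Longrightarrow> y \<in> carrier G \<Longrightarrow> len (x \<otimes> y) = len x + len y - 2 * gp (inv x) y"
  using len_diff_gp[of "inv x" y] by simp

text \<open>
  The product is the distance that the path from \<open>\<one>\<close> over x to xy does not backtrack
  beyond x.
\<close>

lemma gp_prefix:
  assumes "x \<in> carrier G" "y \<in> carrier G"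
  shows "gp x (x \<otimes> y) = len x - gp (inv x) y"
proof -
  have "len y = len x + len (x \<otimes> y) - 2 * gp x (x \<otimes> y)"
    using len_diff_gp[of x "x \<otimes> y"] assms by (simp add: inv_mult_cancel_left)
  then show ?thesis using len_mult_gp[OF assms] by linarith
qed

text \<open>
  Moving the base point changes a Gromov product by at most the distance moved.
\<close>

lemma gp_translate:
  assumes "u \<in> carrier G" "x \<in> carrier G" "y \<in> carrier G"
  shows "\<bar>gp (u \<otimes> x) (u \<otimes> y) - gp x y\<bar> \<le> len u"
proof -
  have "len (u \<otimes> x) \<le> len u + len x" "len (u \<otimes> y) \<le> len u + len y"
    using assms len_mult by auto
  moreover have "len x \<le> len u + len (u \<otimes> x)" "len y \<le> len u + len (u \<otimes> y)"
    using assms len_mult[of "inv u" "u \<otimes> x"] len_mult[of "inv u" "u \<otimes> y"]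
    by (simp_all add: group_norm)
  moreover have "len (inv (u \<otimes> x) \<otimes> (u \<otimes> y)) = len (inv x \<otimes> y)" using assms by (simp add: group_norm)
  ultimately show ?thesis using gp_double[of "u \<otimes> x" "u \<otimes> y"] gp_double[of x y] by linarith
qed

section \<open>Loxodromic elements\<close>

text \<open>
  Stronger than having infinite order: with this margin, the local condition at f already makes
  \<open>n \<mapsto> f^n\<close> a quasi-geodesic with constants read off from f itself.
\<close>

definition loxodromic :: "'a \<Rightarrow> bool" where
  "loxodromic f \<longleftrightarrow> f \<in> carrier G \<and> len f + 3 * \<delta> < len (f \<otimes> f)"

lemma loxodromic_carrier [simp]: "loxodromic f \<Longrightarrow> f \<in> carrier G"
  by (simp add: loxodromic_def)

lemma loxodromic_inv: "loxodromic f \<Longrightarrow> loxodromic (inv f)"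
  unfolding loxodromic_def using len_inv[of "f \<otimes> f"] by (simp add: inv_mult_group)

text \<open>
  The backtracking at each vertex of the path of powers of f.
\<close>

definition turn :: "'a \<Rightarrow> real" where
  "turn f = gp (inv f) f"

lemma turn_inv: "f \<in> carrier G \<Longrightarrow> turn (inv f) = turn f"
  by (simp add: turn_def gp_sym)

lemma loxodromic_turn: "loxodromic f \<Longrightarrow> 2 * turn f + 3 * \<delta> < len f"
  using len_mult_gp[of f f] unfolding loxodromic_def turn_def by linarith

text \<open>
  Local to global: if f^n satisfies the bound, then f and \<open>f f^n\<close> agree for longer than
  inv f and f do. So the turn from inv f to \<open>f f^n\<close> exceeds the turn from inv f to f by at
  most \<open>\<delta>\<close>, and the errors do not accumulate.
\<close>

lemma gp_inv_pow:
  assumes "loxodromic f"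
  shows "gp (inv f) (f [^] (n::nat)) \<le> turn f + \<delta>"
proof (induction n)
  case 0
  then show ?case using gp_nonneg[of "inv f" f] delta_nonneg assms by (simp add: turn_def)
next
  case (Suc n)
  have f: "f \<in> carrier G" using assms by simp
  have "gp f (f \<otimes> f [^] n) \<ge> len f - (turn f + \<delta>)"
    using gp_prefix[of f "f [^] n"] Suc f by simp
  then have "turn f + \<delta> < gp f (f \<otimes> f [^] n)"
    using loxodromic_turn[OF assms] delta_nonneg by linarith
  then have "gp (inv f) (f \<otimes> f [^] n) \<le> turn f + \<delta>"
    using f by (intro gp_transfer[of "inv f" f]) (auto simp: turn_def)
  then show ?case by (simp only: pow_Suc_left[OF f])
qed

lemma gp_inv_pow_pow:
  assumes "loxodromic f"
  shows "gp (inv (f [^] (m::nat))) (f [^] (n::nat)) \<le> turn f + 2 * \<delta>"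
proof (cases m)
  case 0
  then show ?thesis using gp_nonneg[of "inv f" f] delta_nonneg assms by (simp add: turn_def)
next
  case (Suc k)
  have f: "f \<in> carrier G" using assms by simp
  have "gp (inv f) (inv f \<otimes> inv (f [^] k)) \<ge> len f - (turn f + \<delta>)"
    using gp_prefix[of "inv f" "inv (f [^] k)"] gp_inv_pow[OF loxodromic_inv[OF assms], of k] f
    by (simp add: turn_inv nat_pow_inv)
  then have "turn f + 2 * \<delta> < gp (inv f) (inv (f [^] m))"
    using loxodromic_turn[OF assms] delta_nonneg unfolding Suc inv_pow_Suc[OF f] by linarith
  then have "gp (f [^] n) (inv (f [^] m)) \<le> turn f + \<delta> + \<delta>"
    using gp_transfer[of "f [^] n" "inv f" "inv (f [^] m)" "turn f + \<delta>"] gp_inv_pow[OF assms, of n] f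
     gp_sym[of "inv f" "f [^] n"] by simp
  then show ?thesis using gp_sym f by simp
qed

lemma gp_pow_pow:
  assumes "loxodromic f" "m \<le> n"
  shows "len (f [^] (m::nat)) - (turn f + 2 * \<delta>) \<le> gp (f [^] m) (f [^] (n::nat))"
proof -
  have "f [^] n = f [^] m \<otimes> f [^] (n - m)"
    using assms by (simp add: nat_pow_mult)
  then show ?thesis
    using gp_prefix[of "f [^] m" "f [^] (n - m)"] gp_inv_pow_pow[OF assms(1), of m "n - m"] assms by simp
qed

lemma len_pow_Suc_ge:
  assumes "loxodromic f"
  shows "len (f [^] (n::nat)) + (len (f \<otimes> f) - len f - 2 * \<delta>) \<le> len (f [^] Suc n)"
proof -
  have f: "f \<in> carrier G" using assms by simp
  have "len (f \<otimes> f [^] n) = len f + len (f [^] n) - 2 * gp (inv f) (f [^] n)"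
    "len (f \<otimes> f) = len f + len f - 2 * turn f"
    using len_mult_gp f by (simp_all add: turn_def)
  then show ?thesis
    using gp_inv_pow[OF assms, of n] unfolding pow_Suc_left[OF f] by linarith
qed

lemma len_pow_mono:
  assumes "loxodromic f" "m \<le> n"
  shows "len (f [^] (m::nat)) \<le> len (f [^] (n::nat))"
  using assms(2)
proof (induction rule: dec_induct)
  case (step n)
  have "len f + 3 * \<delta> < len (f \<otimes> f)" using assms(1) by (simp add: loxodromic_def)
  then show ?case using step(3) len_pow_Suc_ge[OF assms(1), of n] delta_nonneg by linarith
qed simp

lemma len_pow_unbounded:
  assumes "loxodromic f"
  shows "\<exists>n0. \<forall>n\<ge>n0. r < len (f [^] (n::nat))"
proof -
  define \<eta> where "\<eta> = len (f \<otimes> f) - len f - 2 * \<delta>"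
  have "\<eta> > 0" using assms delta_nonneg unfolding loxodromic_def \<eta>_def by linarith
  have lin: "real n * \<eta> \<le> len (f [^] n)" for n :: nat
  proof (induction n)
    case (Suc n)
    then show ?case using len_pow_Suc_ge[OF assms, of n] by (simp add: \<eta>_def algebra_simps)
  qed simp
  obtain n0 :: nat where "r / \<eta> < real n0" using reals_Archimedean2 by blast
  then have "r < real n0 * \<eta>" using \<open>\<eta> > 0\<close> by (simp add: field_simps)
  then show ?thesis using lin[of n0] len_pow_mono[OF assms, of n0] by (meson le_less_trans less_le_trans)
qed

text \<open>
  A point z that lies near a geodesic from \<open>\<one>\<close> to a power of f is near some power of f:
  the lengths of the powers grow in steps of at most |f|, so one of them has about the length of z,
  and two points near the same geodesic with about the same length are close.
\<close>

lemma track_power: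
  assumes "loxodromic f" "z \<in> carrier G" and near: "len z - (turn f + 4 * \<delta>) \<le> gp z (f [^] (N::nat))"
  shows "\<exists>m::nat. len (inv (f [^] m) \<otimes> z) \<le> len f + 3 * (turn f + 4 * \<delta>) + 2 * \<delta>"
proof -
  define c where "c = turn f + 4 * \<delta>"
  have f: "f \<in> carrier G" using assms(1) by simp
  have c0: "0 \<le> c" using gp_nonneg[of "inv f" f] delta_nonneg f by (simp add: c_def turn_def)
  define M where "M = {m. m \<le> N \<and> len (f [^] m) \<le> len z}"
  define m where "m = Max M"
  have M: "finite M" "0 \<in> M" using len_nonneg[OF assms(2)] by (simp_all add: M_def)
  have "m \<in> M" unfolding m_def using M by (intro Max_in) auto
  then have m: "m \<le> N" "len (f [^] m) \<le> len z" by (auto simp: M_def)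
  have gap: "len z - len (f [^] m) \<le> len f + c"
  proof (cases "m = N")
    case True
    have "gp z (f [^] N) \<le> len (f [^] N)" using gp_le_right f assms(2) by simp
    then show ?thesis using near len_nonneg[OF f] unfolding True c_def by linarith
  next
    case False
    have "Suc m \<notin> M" using Max_ge[OF M(1), of "Suc m"] unfolding m_def by linarith
    then have "len z < len (f [^] Suc m)" using m False by (auto simp: M_def)
    also have "\<dots> \<le> len (f [^] m) + len f" using len_mult[of "f [^] m" f] f by simp
    finally show ?thesis using c0 by linarith
  qed
  have "gp (f [^] N) (f [^] m) \<ge> len (f [^] m) - c"
    using gp_pow_pow[OF assms(1) m(1)] gp_sym[of "f [^] N" "f [^] m"] f delta_nonneg unfolding c_def by simp
  then have "gp z (f [^] m) \<ge> len (f [^] m) - c - \<delta>"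
    using gp_hyp[of z "f [^] N" "f [^] m"] near m f assms(2) unfolding c_def by simp
  then have "len (inv (f [^] m) \<otimes> z) \<le> len f + 3 * c + 2 * \<delta>"
    using len_diff_gp[of "f [^] m" z] gp_sym[of z "f [^] m"] gap f assms(2) by simp
  then show ?thesis unfolding c_def by blast
qed

text \<open>
  For loxodromic f: the sequences f^n and h f^n converge to the same boundary point.
\<close>

definition fellow :: "'a \<Rightarrow> 'a \<Rightarrow> bool" where
  "fellow f h \<longleftrightarrow> (\<forall>T. \<exists>N M. T < gp (f [^] (N::nat)) (h \<otimes> f [^] (M::nat)))"

text \<open>
  The bound does not depend on h; only the threshold n0, from which on the two rays run side by
  side, does.
\<close>

lemma fellow_track:
  assumes "loxodromic f" "h \<in> carrier G" "fellow f h"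
  shows "\<exists>n0. \<forall>n\<ge>n0. \<exists>m::nat. len (inv (f [^] m) \<otimes> (h \<otimes> f [^] (n::nat)))
           \<le> len f + 3 * (turn f + 4 * \<delta>) + 2 * \<delta>"
proof -
  have f: "f \<in> carrier G" and h: "h \<in> carrier G" using assms by simp_all
  obtain n0 :: nat where n0: "\<And>n. n \<ge> n0 \<Longrightarrow> turn f + 3 * \<delta> + len h < len (f [^] n)"
    using len_pow_unbounded[OF assms(1)] by blast
  show ?thesis
  proof (rule exI[of _ n0], intro allI impI)
    fix n assume "n0 \<le> n"
    define z where "z = h \<otimes> f [^] n"
    have z: "z \<in> carrier G" using f h by (simp add: z_def)
    obtain N M :: nat where NM: "len h + real n * len f + len z < gp (f [^] N) (h \<otimes> f [^] M)"
      using assms(3) unfolding fellow_def by blast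
    have pow_le: "len (f [^] k) \<le> real k * len f" for k :: nat
    proof (induction k)
      case (Suc k)
      have "len (f [^] k \<otimes> f) \<le> len (f [^] k) + len f" using len_mult f by simp
      also have "\<dots> \<le> real k * len f + len f" using Suc by simp
      finally show ?case using f by (simp add: algebra_simps)
    qed simp
    have "gp (f [^] N) (h \<otimes> f [^] M) \<le> len (h \<otimes> f [^] M)" using gp_le_right f h by simp
    also have "\<dots> \<le> len h + real M * len f" using len_mult[of h "f [^] M"] pow_le[of M] f h by simp
    finally have "real n * len f < real M * len f" using NM len_nonneg[OF z] by linarith
    then have "n \<le> M" using mult_right_mono[of "real M" "real n" "len f"] len_nonneg[OF f] by linarith
    define w where "w = f [^] (M - n)"
    have w: "w \<in> carrier G" using f by (simp add: w_def)
    have zw: "z \<otimes> w = h \<otimes> f [^] M" using f h \<open>n \<le> M\<close> by (simp add: z_def w_def m_assoc nat_pow_mult)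
    have "gp (inv (f [^] n)) (inv (f [^] n) \<otimes> inv h) = len (f [^] n) - gp (f [^] n) (inv h)"
      using gp_prefix[of "inv (f [^] n)" "inv h"] f h by simp
    moreover have "gp (f [^] n) (inv h) \<le> len h" using gp_le_right[of "f [^] n" "inv h"] f h by simp
    ultimately have "turn f + 2 * \<delta> + \<delta> < gp (inv (f [^] n)) (inv z)"
      using n0[OF \<open>n0 \<le> n\<close>] f h by (simp add: z_def inv_mult_group)
    moreover have "gp w (inv (f [^] n)) \<le> turn f + 2 * \<delta>"
      using gp_inv_pow_pow[OF assms(1), of n "M - n"] gp_sym[of w "inv (f [^] n)"] f by (simp add: w_def)
    ultimately have "gp w (inv z) \<le> turn f + 2 * \<delta> + \<delta>" using gp_transfer[of w "inv (f [^] n)" "inv z" "turn f + 2 * \<delta>"] f z w by simp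
    then have "len z - (turn f + 3 * \<delta>) \<le> gp z (h \<otimes> f [^] M)"
      using gp_prefix[OF z w] zw gp_sym[of w "inv z"] z w by simp
    moreover have "len z \<le> gp (h \<otimes> f [^] M) (f [^] N)"
    proof -
      have "gp (f [^] N) (h \<otimes> f [^] M) = gp (h \<otimes> f [^] M) (f [^] N)" using gp_sym f h by simp
      moreover have "0 \<le> real n * len f" using len_nonneg[OF f] by simp
      ultimately show ?thesis using NM len_nonneg[OF h] by linarith
    qed
    moreover have "0 \<le> turn f" using gp_nonneg[of "inv f" f] f by (simp add: turn_def)
    ultimately have "len z - (turn f + 4 * \<delta>) \<le> gp z (f [^] N)"
      using gp_hyp[of z "h \<otimes> f [^] M" "f [^] N"] f h z delta_nonneg by simp
    then show "\<exists>m::nat. len (inv (f [^] m) \<otimes> (h \<otimes> f [^] n)) \<le> len f + 3 * (turn f + 4 * \<delta>) + 2 * \<delta>"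
      using track_power[OF assms(1) z] unfolding z_def by blast
  qed
qed

end

section \<open>The stabilizer of an end\<close>

context group
begin

lemma intertwine_pow:
  assumes "h \<in> carrier G" "x \<in> carrier G" "y \<in> carrier G" "h \<otimes> x = y \<otimes> h"
  shows "h \<otimes> x [^] (t::nat) = y [^] t \<otimes> h"
proof (induction t)
  case 0
  show ?case using assms by simp
next
  case (Suc t)
  have "h \<otimes> x [^] Suc t = (h \<otimes> x [^] t) \<otimes> x" using assms by (simp add: m_assoc)
  also have "\<dots> = y [^] t \<otimes> (h \<otimes> x)" unfolding Suc using assms by (simp add: m_assoc)
  also have "\<dots> = y [^] Suc t \<otimes> h" unfolding assms(4) using assms by (simp add: m_assoc)
  finally show ?case .
qed

lemma intertwine_inv:
  assumes "h \<in> carrier G" "x \<in> carrier G" "y \<in> carrier G" "h \<otimes> x = y \<otimes> h"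
  shows "h \<otimes> inv x = inv y \<otimes> h"
proof -
  have "inv y \<otimes> h = inv y \<otimes> ((h \<otimes> x) \<otimes> inv x)" using assms(1-3) by (simp add: m_assoc)
  also have "\<dots> = h \<otimes> inv x" unfolding assms(4) using assms(1-3) by (simp add: m_assoc inv_mult_cancel_left)
  finally show ?thesis by simp
qed

definition subsemigroup :: "'a set \<Rightarrow> bool" where
  "subsemigroup P \<longleftrightarrow> P \<subseteq> carrier G \<and> (\<forall>a\<in>P. \<forall>b\<in>P. a \<otimes> b \<in> P)"

lemma subsemigroup_subset: "subsemigroup P \<Longrightarrow> P \<subseteq> carrier G"
  and subsemigroup_mult: "subsemigroup P \<Longrightarrow> a \<in> P \<Longrightarrow> b \<in> P \<Longrightarrow> a \<otimes> b \<in> P"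
  by (auto simp: subsemigroup_def)

text \<open>
  For loxodromic f this is the stabilizer of the limit point of the powers f^n. Requiring positive
  exponents on both sides excludes elements that exchange the two ends.
\<close>

definition end_stab :: "'a \<Rightarrow> 'a set" where
  "end_stab f = {h \<in> carrier G. \<exists>p>0. \<exists>q>0. h \<otimes> f [^] (p::nat) = f [^] (q::nat) \<otimes> h}"

lemma subgroup_end_stab:
  assumes f: "f \<in> carrier G"
  shows "subgroup (end_stab f) G"
proof (rule subgroupI)
  show "end_stab f \<subseteq> carrier G" by (auto simp: end_stab_def)
  have "\<one> \<in> end_stab f" using f by (auto simp: end_stab_def intro!: exI[of _ 1])
  then show "end_stab f \<noteq> {}" by blast
next
  fix h assume "h \<in> end_stab f"
  then obtain p q :: nat where h: "h \<in> carrier G" and pq: "p > 0" "q > 0" "h \<otimes> f [^] p = f [^] q \<otimes> h"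
    by (auto simp: end_stab_def)
  have "inv h \<otimes> f [^] q = inv h \<otimes> ((f [^] q \<otimes> h) \<otimes> inv h)" using h f by (simp add: m_assoc)
  also have "\<dots> = f [^] p \<otimes> inv h"
    unfolding pq(3)[symmetric] using h f by (simp add: m_assoc inv_mult_cancel_left)
  finally show "inv h \<in> end_stab f" using h pq by (auto simp: end_stab_def)
next
  fix h k assume "h \<in> end_stab f" "k \<in> end_stab f"
  then obtain p q r s :: nat where h: "h \<in> carrier G" and pq: "p > 0" "q > 0" "h \<otimes> f [^] p = f [^] q \<otimes> h"
    and k: "k \<in> carrier G" and rs: "r > 0" "s > 0" "k \<otimes> f [^] r = f [^] s \<otimes> k"
    by (auto simp: end_stab_def)
  have "k \<otimes> f [^] (r * p) = f [^] (s * p) \<otimes> k"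
    using intertwine_pow[OF k _ _ rs(3), of p] f by (simp add: nat_pow_pow)
  moreover have "h \<otimes> f [^] (s * p) = f [^] (q * s) \<otimes> h"
    using intertwine_pow[OF h _ _ pq(3), of s] f by (simp add: nat_pow_pow mult.commute)
  ultimately have "(h \<otimes> k) \<otimes> f [^] (r * p) = f [^] (q * s) \<otimes> (h \<otimes> k)"
    using h k f by (simp add: m_assoc) (simp add: m_assoc[symmetric])
  moreover have "r * p > 0" "q * s > 0" using pq rs by simp_all
  ultimately show "h \<otimes> k \<in> end_stab f" using h k unfolding end_stab_def by blast
qed

lemma self_in_end_stab: "f \<in> carrier G \<Longrightarrow> f \<in> end_stab f"
  by (auto simp: end_stab_def intro!: exI[of _ 1])

lemma end_stab_inv_subset: "f \<in> carrier G \<Longrightarrow> end_stab f \<subseteq> end_stab (inv f)"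
  unfolding end_stab_def
  by (auto simp: nat_pow_inv intro: intertwine_inv)

text \<open>
  An element of this group that fixes one end of the axis of f fixes the other.
\<close>

lemma end_stab_inv: "f \<in> carrier G \<Longrightarrow> end_stab (inv f) = end_stab f"
  using end_stab_inv_subset[of f] end_stab_inv_subset[of "inv f"] by auto

text \<open>
  The hypothesis speaks of left cosets in the big group, the definition of right cosets inside K;
  inversion translates between the two because K is closed under it.
\<close>

lemma virtually_cyclicI:
  assumes K: "subgroup K G" and f: "f \<in> K" and E: "finite E" "E \<subseteq> carrier G"
    and cover: "K \<subseteq> (\<Union>e\<in>E. e <#\<^bsub>G\<^esub> generate G {f})"
  shows "virtually_cyclic (G\<lparr>carrier := K\<rparr>)"
proof -
  define C where "C = generate G {f}"
  have fG: "f \<in> carrier G" using K f subgroup.mem_carrier by fast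
  have C: "subgroup C G" unfolding C_def using fG by (intro generate_is_subgroup) simp
  have CK: "C \<subseteq> K" unfolding C_def using K f by (intro generate_subgroup_incl) auto
  have 1: "subgroup C (G\<lparr>carrier := K\<rparr>)" using subgroup_incl[OF C K CK] .
  have 2: "cyclic_group (G\<lparr>carrier := C\<rparr>)"
    using cyclic_group_generated[of f] fG by (simp add: subgroup_generated_def C_def)
  have "rcosets\<^bsub>G\<lparr>carrier := K\<rparr>\<^esub> C \<subseteq> (\<lambda>e. C #> inv e) ` E"
  proof
    fix R assume "R \<in> rcosets\<^bsub>G\<lparr>carrier := K\<rparr>\<^esub> C"
    then obtain x where x: "x \<in> K" "R = C #> x" by (auto simp: RCOSETS_def)
    have xG: "x \<in> carrier G" using x K subgroup.mem_carrier by fast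
    have "inv x \<in> K" using x K subgroup.m_inv_closed by fast
    then obtain e c where e: "e \<in> E" and c: "c \<in> C" and xe: "inv x = e \<otimes> c"
      using cover by (auto simp: l_coset_def C_def)
    have eG: "e \<in> carrier G" and cG: "c \<in> carrier G" using e c E C subgroup.mem_carrier by fast+
    have "x = inv c \<otimes> inv e" using xe xG eG cG by (metis inv_inv inv_mult_group)
    then have "R = (C #> inv c) #> inv e"
      using x eG cG C by (simp add: coset_mult_assoc subgroup.subset)
    also have "C #> inv c = C" using C c by (simp add: coset_join2 cG subgroup.m_inv_closed)
    finally show "R \<in> (\<lambda>e. C #> inv e) ` E" using e by blast
  qed
  then have "finite (rcosets\<^bsub>G\<lparr>carrier := K\<rparr>\<^esub> C)" using E finite_subset by blast
  then show ?thesis unfolding virtually_cyclic_def using 1 2 by auto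
qed

text \<open>
  An element of P maps the set of cosets met by P into itself injectively, hence, this set being
  finite, permutes it; so its inverse also preserves it although it need not belong to P.
  The element f puts the identity into the union of these cosets.
\<close>

lemma generate_subset_of_finite_orbit:
  assumes P: "subsemigroup P"
    and H: "subgroup H G" and f: "f \<in> P" "f \<in> H"
    and fin: "finite ((\<lambda>u. u <#\<^bsub>G\<^esub> H) ` P)"
  shows "generate G P \<subseteq> (\<Union>u\<in>P. u <#\<^bsub>G\<^esub> H)"
proof -
  note PG = subsemigroup_subset[OF P]
  define \<O> where "\<O> = (\<lambda>u. u <#\<^bsub>G\<^esub> H) ` P"
  define W where "W = \<Union>\<O>"
  have HG: "H \<subseteq> carrier G" using H by (rule subgroup.subset)
  have OG: "K \<subseteq> carrier G" if "K \<in> \<O>" for K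
    using that PG l_coset_subset_G[OF HG] unfolding \<O>_def by blast
  have cancel: "inv b <#\<^bsub>G\<^esub> (b <#\<^bsub>G\<^esub> K) = K" if "b \<in> P" "K \<in> \<O>" for b K
    using that PG OG[OF that(2)] lcos_m_assoc[of K "inv b" b] by (auto simp: lcos_mult_one)
  have maps: "b <#\<^bsub>G\<^esub> K \<in> \<O>" if b: "b \<in> P" and K: "K \<in> \<O>" for b K
  proof -
    obtain u where "u \<in> P" "K = u <#\<^bsub>G\<^esub> H" using K by (auto simp: \<O>_def)
    moreover have "b <#\<^bsub>G\<^esub> (u <#\<^bsub>G\<^esub> H) = (b \<otimes> u) <#\<^bsub>G\<^esub> H"
      using lcos_m_assoc[of H b u] b PG HG \<open>u \<in> P\<close> by blast
    ultimately show ?thesis using subsemigroup_mult[OF P b \<open>u \<in> P\<close>] unfolding \<O>_def by simp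
  qed
  have pull: "inv b <#\<^bsub>G\<^esub> K \<in> \<O>" if b: "b \<in> P" and K: "K \<in> \<O>" for b K
  proof -
    have "inj_on (\<lambda>K. b <#\<^bsub>G\<^esub> K) \<O>" using cancel[OF b] by (metis inj_onI)
    moreover have "(\<lambda>K. b <#\<^bsub>G\<^esub> K) ` \<O> \<subseteq> \<O>" using maps[OF b] by blast
    ultimately have "(\<lambda>K. b <#\<^bsub>G\<^esub> K) ` \<O> = \<O>" using fin unfolding \<O>_def by (intro endo_inj_surj)
    then obtain K' where "K' \<in> \<O>" "K = b <#\<^bsub>G\<^esub> K'" using K by blast
    then show ?thesis using cancel[OF b] by simp
  qed
  have step: "x \<otimes> w \<in> W" if "w \<in> W" "\<And>K. K \<in> \<O> \<Longrightarrow> x <#\<^bsub>G\<^esub> K \<in> \<O>" for x w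
    using that by (auto simp: W_def l_coset_def)
  have WG: "W \<subseteq> carrier G" using OG by (auto simp: W_def)
  have act: "\<forall>w\<in>W. x \<otimes> w \<in> W" if "x \<in> generate G P" for x
    using that
  proof (induction rule: generate.induct)
    case one then show ?case using WG by auto
  next
    case (incl h) then show ?case using step maps by blast
  next
    case (inv h) then show ?case using step pull by blast
  next
    case (eng h1 h2)
    then show ?case using generate_in_carrier[OF PG] WG by (auto simp: m_assoc subset_iff)
  qed
  have "f \<otimes> inv f \<in> W"
    using f subgroup.m_inv_closed[OF H] by (auto simp: W_def \<O>_def l_coset_def)
  then have "\<one> \<in> W" using f PG by auto
  then have "generate G P \<subseteq> W" using act generate_in_carrier[OF PG] by (metis r_one subsetI)
  then show ?thesis by (simp add: W_def \<O>_def)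
qed

end

context hyperbolic_length
begin

text \<open>
  Every far point h f^n is within a bounded distance of some f^m, so by finiteness of balls the same
  quotient \<open>inv (f^m) h f^n\<close> occurs for two different n, and comparing the two occurrences
  gives a commutation relation.
\<close>

lemma fellow_imp_end_stab:
  assumes "loxodromic f" "h \<in> carrier G" "fellow f h"
  shows "h \<in> end_stab f"
    and "\<exists>m n. \<exists>b\<in>carrier G. len b \<le> len f + 3 * (turn f + 4 * \<delta>) + 2 * \<delta> \<and>
           h = f [^] (m::nat) \<otimes> b \<otimes> inv (f [^] (n::nat))"
proof -
  define K where "K = len f + 3 * (turn f + 4 * \<delta>) + 2 * \<delta>"
  have f: "f \<in> carrier G" and h: "h \<in> carrier G" using assms by simp_all
  obtain n0 :: nat where "\<forall>n\<ge>n0. \<exists>m::nat. len (inv (f [^] m) \<otimes> (h \<otimes> f [^] n)) \<le> K"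
    using fellow_track[OF assms] unfolding K_def by blast
  then obtain m :: "nat \<Rightarrow> nat" where m: "\<And>n. n \<ge> n0 \<Longrightarrow> len (inv (f [^] m n) \<otimes> (h \<otimes> f [^] n)) \<le> K"
    by metis
  define b where "b n = inv (f [^] m n) \<otimes> (h \<otimes> f [^] n)" for n
  have bG: "b n \<in> carrier G" for n using f h by (simp add: b_def)
  have fb: "f [^] m n \<otimes> b n = h \<otimes> f [^] n" for n
    using f h by (simp add: b_def mult_inv_cancel_left)
  have "h = f [^] m n0 \<otimes> b n0 \<otimes> inv (f [^] n0)" unfolding fb using f h by (simp add: m_assoc)
  moreover have "len (b n0) \<le> K" using m[of n0] by (simp add: b_def)
  ultimately show "\<exists>m n. \<exists>b\<in>carrier G. len b \<le> len f + 3 * (turn f + 4 * \<delta>) + 2 * \<delta> \<and>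
           h = f [^] (m::nat) \<otimes> b \<otimes> inv (f [^] (n::nat))"
    using bG unfolding K_def by blast
  have "b ` {n0..} \<subseteq> {x \<in> carrier G. len x \<le> K}" using m bG by (auto simp: b_def)
  then have "finite (b ` {n0..})" using finite_ball finite_subset by blast
  then obtain n1 where n1: "n1 \<ge> n0" "infinite {n \<in> {n0..}. b n = b n1}"
    using pigeonhole_infinite[of "{n0..}" b] infinite_Ici by auto
  \<comment> \<open>The second occurrence is taken so far out that its exponent m also exceeds the first one;
    this is what makes both exponents of the relation positive.\<close>
  obtain N :: nat where N: "\<And>n. n \<ge> N \<Longrightarrow> len h + K + len (f [^] m n1) < len (f [^] n)"
    using len_pow_unbounded[OF assms(1)] by blast
  obtain n2 where "n2 \<in> {n \<in> {n0..}. b n = b n1}" "n2 > max N n1"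
    using n1(2) by (meson infinite_nat_iff_unbounded)
  then have n2: "n2 \<ge> n0" "b n2 = b n1" "n2 > N" "n2 > n1" by auto
  have "len (f [^] n2) \<le> len h + len (h \<otimes> f [^] n2)"
    using len_mult[of "inv h" "h \<otimes> f [^] n2"] f h by (simp add: inv_mult_cancel_left)
  moreover have "len (h \<otimes> f [^] n2) \<le> len (f [^] m n2) + len (b n2)"
    unfolding fb[symmetric] using len_mult f bG by simp
  moreover have "len (b n2) \<le> K" using m[OF n2(1)] by (simp add: b_def)
  ultimately have "len (f [^] m n1) < len (f [^] m n2)" using N[of n2] n2 by linarith
  then have mm: "m n1 < m n2" using len_pow_mono[OF assms(1), of "m n2" "m n1"] by linarith
  define d e where "d = m n2 - m n1" and "e = n2 - n1"
  have "(f [^] d \<otimes> h) \<otimes> f [^] n1 = f [^] d \<otimes> (f [^] m n1 \<otimes> b n1)"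
    unfolding fb using f h by (simp add: m_assoc)
  also have "\<dots> = f [^] m n2 \<otimes> b n2"
    using f bG mm n2(2) by (simp add: m_assoc[symmetric] nat_pow_mult d_def)
  also have "\<dots> = (h \<otimes> f [^] e) \<otimes> f [^] n1"
    unfolding fb using f h n2(4) by (simp add: m_assoc nat_pow_mult e_def)
  finally have "f [^] d \<otimes> h = h \<otimes> f [^] e" using f h by simp
  moreover have "d > 0" "e > 0" using mm n2 by (auto simp: d_def e_def)
  ultimately show "h \<in> end_stab f" unfolding end_stab_def using h by (metis (mono_tags, lifting) mem_Collect_eq)
qed

lemma end_stab_imp_fellow:
  assumes "loxodromic f" "h \<in> end_stab f"
  shows "fellow f h"
  unfolding fellow_def
proof
  fix T
  have f: "f \<in> carrier G" using assms by simp
  obtain p q :: nat where h: "h \<in> carrier G" and pq: "p > 0" "q > 0" "h \<otimes> f [^] p = f [^] q \<otimes> h"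
    using assms by (auto simp: end_stab_def)
  obtain t :: nat where t: "\<And>n. n \<ge> t \<Longrightarrow> T + len h < len (f [^] n)"
    using len_pow_unbounded[OF assms(1)] by blast
  have eq: "h \<otimes> f [^] (p * t) = f [^] (q * t) \<otimes> h"
    using intertwine_pow[OF h _ _ pq(3), of t] f by (simp add: nat_pow_pow)
  have "gp (f [^] (q * t)) (f [^] (q * t) \<otimes> h) \<ge> len (f [^] (q * t)) - len h"
    using gp_prefix[of "f [^] (q * t)" h] gp_le_right[of "inv (f [^] (q * t))" h] f h by simp
  moreover have "T + len h < len (f [^] (q * t))" using t[of "q * t"] pq by simp
  ultimately have "T < gp (f [^] (q * t)) (h \<otimes> f [^] (p * t))" unfolding eq by linarith
  then show "\<exists>N M. T < gp (f [^] (N::nat)) (h \<otimes> f [^] (M::nat))" by blast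
qed

text \<open>
  Each h in the stabilizer is f^m b f^-n with b in a fixed ball. The commutation relation of b lets
  f^m pass b up to the remainder of m modulo the exponent attached to b, which leaves finitely many
  possibilities for the part before the final power of f.
\<close>

lemma end_stab_finite_cosets:
  assumes "loxodromic f"
  shows "\<exists>D. finite D \<and> D \<subseteq> carrier G \<and> end_stab f \<subseteq> (\<Union>d\<in>D. d <#\<^bsub>G\<^esub> generate G {f})"
proof -
  have f: "f \<in> carrier G" using assms by simp
  define C where "C = generate G {f}"
  have C: "subgroup C G" unfolding C_def using f by (intro generate_is_subgroup) simp
  have fC: "f [^] (k::nat) \<in> C" for k
  proof (induction k)
    case (Suc k)
    moreover have "f \<in> C" unfolding C_def by (simp add: generate.incl)
    ultimately show ?case using subgroup.m_closed[OF C] by simp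
  qed (use C in \<open>simp add: subgroup.one_closed\<close>)
  define B where "B = {b \<in> end_stab f. len b \<le> len f + 3 * (turn f + 4 * \<delta>) + 2 * \<delta>}"
  have finB: "finite B"
    by (rule finite_subset[OF _ finite_ball]) (auto simp: B_def end_stab_def)
  have "\<forall>b\<in>B. \<exists>q>0. \<exists>p. b \<otimes> f [^] (p::nat) = f [^] (q::nat) \<otimes> b"
    by (auto simp: B_def end_stab_def)
  then obtain q p :: "'a \<Rightarrow> nat" where qp: "\<And>b. b \<in> B \<Longrightarrow> q b > 0 \<and> b \<otimes> f [^] p b = f [^] q b \<otimes> b"
    by metis
  define D where "D = (\<Union>b\<in>B. (\<lambda>r. f [^] r \<otimes> b) ` {..<q b})"
  have "finite D" using finB by (simp add: D_def)
  moreover have "D \<subseteq> carrier G" using f by (auto simp: D_def B_def end_stab_def)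
  moreover have "end_stab f \<subseteq> (\<Union>d\<in>D. d <#\<^bsub>G\<^esub> C)"
  proof
    fix h assume hH: "h \<in> end_stab f"
    then have h: "h \<in> carrier G" by (simp add: end_stab_def)
    obtain m n :: nat and b where b: "b \<in> carrier G" "len b \<le> len f + 3 * (turn f + 4 * \<delta>) + 2 * \<delta>"
      and hb: "h = f [^] m \<otimes> b \<otimes> inv (f [^] n)"
      using fellow_imp_end_stab(2)[OF assms h end_stab_imp_fellow[OF assms hH]] by blast
    interpret H: subgroup "end_stab f" G using subgroup_end_stab[OF f] .
    have fH: "f [^] (k::nat) \<in> end_stab f" for k
      by (induction k) (auto simp: self_in_end_stab[OF f])
    have "b = inv (f [^] m) \<otimes> h \<otimes> f [^] n"
      unfolding hb using f b by (simp add: m_assoc inv_mult_cancel_left)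
    then have "b \<in> end_stab f" using fH hH by simp
    then have bB: "b \<in> B" using b by (simp add: B_def)
    define r t where "r = m mod q b" and "t = m div q b"
    have "f [^] m = f [^] r \<otimes> f [^] (q b * t)"
      using f by (simp add: nat_pow_mult r_def t_def)
    moreover have "b \<otimes> f [^] (p b * t) = f [^] (q b * t) \<otimes> b"
      using intertwine_pow[of b "f [^] p b" "f [^] q b" t] qp[OF bB] b f by (simp add: nat_pow_pow)
    ultimately have "h = (f [^] r \<otimes> b) \<otimes> (f [^] (p b * t) \<otimes> inv (f [^] n))"
      unfolding hb using f b by (simp add: m_assoc) (simp add: m_assoc[symmetric])
    moreover have "f [^] r \<otimes> b \<in> D" using qp[OF bB] unfolding D_def r_def
      by (intro UN_I[OF bB] imageI) simp
    moreover have "f [^] (p b * t) \<otimes> inv (f [^] n) \<in> C"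
      using fC C by (simp add: subgroup.m_closed subgroup.m_inv_closed)
    ultimately show "h \<in> (\<Union>d\<in>D. d <#\<^bsub>G\<^esub> C)" unfolding l_coset_def by blast
  qed
  ultimately show ?thesis unfolding C_def by blast
qed

lemma virtually_cyclic_of_finite_orbit:
  assumes P: "subsemigroup P"
    and f: "f \<in> P" "loxodromic f"
    and fin: "finite ((\<lambda>u. u <#\<^bsub>G\<^esub> end_stab f) ` P)"
  shows "virtually_cyclic (G\<lparr>carrier := generate G P\<rparr>)"
proof -
  note PG = subsemigroup_subset[OF P]
  have fG: "f \<in> carrier G" using f by simp
  obtain U where U: "U \<subseteq> P" "finite U" "(\<lambda>u. u <#\<^bsub>G\<^esub> end_stab f) ` P = (\<lambda>u. u <#\<^bsub>G\<^esub> end_stab f) ` U"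
    using finite_subset_image[OF fin subset_refl] by metis
  obtain D where D: "finite D" "D \<subseteq> carrier G" "end_stab f \<subseteq> (\<Union>d\<in>D. d <#\<^bsub>G\<^esub> generate G {f})"
    using end_stab_finite_cosets[OF f(2)] by blast
  define E where "E = (\<lambda>(u, d). u \<otimes> d) ` (U \<times> D)"
  have "generate G P \<subseteq> (\<Union>u\<in>P. u <#\<^bsub>G\<^esub> end_stab f)"
    using generate_subset_of_finite_orbit[OF P subgroup_end_stab[OF fG] f(1) self_in_end_stab[OF fG] fin] .
  also have "\<dots> = (\<Union>u\<in>U. u <#\<^bsub>G\<^esub> end_stab f)" using U(3) by blast
  also have "\<dots> \<subseteq> (\<Union>e\<in>E. e <#\<^bsub>G\<^esub> generate G {f})"
  proof
    fix x assume "x \<in> (\<Union>u\<in>U. u <#\<^bsub>G\<^esub> end_stab f)"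
    then obtain u h where u: "u \<in> U" "h \<in> end_stab f" "x = u \<otimes> h" by (auto simp: l_coset_def)
    then obtain d c where d: "d \<in> D" "c \<in> generate G {f}" "h = d \<otimes> c"
      using D by (auto simp: l_coset_def)
    have "c \<in> carrier G" using d generate_in_carrier[of "{f}"] fG by auto
    then have "x = (u \<otimes> d) \<otimes> c" using u d U D PG by (simp add: m_assoc subset_iff)
    moreover have "u \<otimes> d \<in> E" using u d by (auto simp: E_def)
    ultimately show "x \<in> (\<Union>e\<in>E. e <#\<^bsub>G\<^esub> generate G {f})" using d by (auto simp: l_coset_def)
  qed
  finally have "generate G P \<subseteq> (\<Union>e\<in>E. e <#\<^bsub>G\<^esub> generate G {f})" .
  moreover have "finite E" using U D by (simp add: E_def)
  moreover have "E \<subseteq> carrier G"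
    unfolding E_def using U(1) D(2) PG by (auto intro!: m_closed)
  moreover have "f \<in> generate G P" using f by (simp add: generate.incl)
  ultimately show ?thesis using virtually_cyclicI generate_is_subgroup[OF PG] by blast
qed

section \<open>Existence of loxodromic elements\<close>

lemma exists_long:
  assumes "infinite P" "P \<subseteq> carrier G"
  shows "\<exists>x\<in>P. r < len x"
proof (rule ccontr)
  assume "\<not> ?thesis"
  then have "P \<subseteq> {x \<in> carrier G. len x \<le> r}" using assms by force
  then show False using assms finite_ball finite_subset by blast
qed

text \<open>
  Since neither a nor b is loxodromic, a and inv a agree for about half of their length, and so do b
  and inv b. If the cancellation t in ab were smaller than that, ab and its inverse would agree only
  for about t, which is then less than half of |ab|, and ab would be loxodromic.
\<close>

lemma non_loxodromic_gp_pair: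
  assumes P: "subsemigroup P"
    and non: "\<forall>f\<in>P. \<not> loxodromic f" and a: "a \<in> P" and b: "b \<in> P"
  shows "min (len a) (len b) / 2 - 6 * \<delta> \<le> gp (inv a) b"
    and "min (len a) (len b) / 2 - 7 * \<delta> \<le> gp a b"
proof -
  note PG = subsemigroup_subset[OF P]
  have aG: "a \<in> carrier G" and bG: "b \<in> carrier G" using a b PG by auto
  have self: "len f / 2 - 3 / 2 * \<delta> \<le> gp (inv f) f" if "f \<in> P" for f
  proof -
    have "f \<in> carrier G" using that PG by blast
    then show ?thesis using bspec[OF non that] len_mult_gp[of f f] unfolding loxodromic_def by simp
  qed
  show *: "min (len a) (len b) / 2 - 6 * \<delta> \<le> gp (inv a) b"
  proof (rule ccontr)
    define t where "t = gp (inv a) b"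
    assume "\<not> ?thesis"
    then have ta: "t < len a / 2 - 6 * \<delta>" and tb: "t < len b / 2 - 6 * \<delta>" by (auto simp: t_def)
    \<comment> \<open>Cancellation t in ab passes on, with one additional error at a time, to the cancellation
      in (ab)(ab).\<close>
    have 1: "gp b a \<le> t + \<delta>"
      using self[OF a] ta aG bG delta_nonneg gp_sym[of b "inv a"]
      by (intro gp_transfer[of b "inv a" a]) (auto simp: t_def)
    have 2: "gp a (inv b) \<le> t + \<delta> + \<delta>"
      using self[OF b] tb 1 aG bG delta_nonneg gp_sym[of b "inv b"] gp_sym[of a b]
      by (intro gp_transfer[of a b "inv b"]) auto
    have "gp a (a \<otimes> b) = len a - t" using gp_prefix aG bG by (simp add: t_def)
    then have 3: "gp (inv b) (a \<otimes> b) \<le> t + \<delta> + \<delta> + \<delta>"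
      using ta 2 aG bG delta_nonneg gp_sym[of a "inv b"]
      by (intro gp_transfer[of "inv b" a "a \<otimes> b"]) auto
    have "gp (inv b) (inv b \<otimes> inv a) = len b - t"
      using gp_prefix[of "inv b" "inv a"] aG bG gp_sym[of b "inv a"] by (simp add: t_def)
    then have 4: "gp (a \<otimes> b) (inv (a \<otimes> b)) \<le> t + \<delta> + \<delta> + \<delta> + \<delta>"
      using tb 3 aG bG delta_nonneg gp_sym[of "a \<otimes> b" "inv b"]
      by (intro gp_transfer[of "a \<otimes> b" "inv b" "inv (a \<otimes> b)" "t + \<delta> + \<delta> + \<delta>"]) (auto simp: inv_mult_group)
    have "len (a \<otimes> b) = len a + len b - 2 * t" using len_mult_gp aG bG by (simp add: t_def)
    moreover have "gp (inv (a \<otimes> b)) (a \<otimes> b) = gp (a \<otimes> b) (inv (a \<otimes> b))" using gp_sym aG bG by simp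
    ultimately show False using self[OF subsemigroup_mult[OF P a b]] 4 ta tb delta_nonneg by argo
  qed
  have "gp a (inv a) = gp (inv a) a" using gp_sym aG by simp
  then show "min (len a) (len b) / 2 - 7 * \<delta> \<le> gp a b"
    using gp_hyp[of a "inv a" b] self[OF a] * delta_nonneg aG bG by (auto simp: min_def split: if_splits)
qed

text \<open>
  Both b and ab run along p for the whole length of p, and so does the translate a p, because a
  shifts the geodesic to b onto one that joins the geodesic to ab. Hence p and a p are points of one
  ray, and since a cancels half of its length against p in either order, neither of them is much
  farther out than the other.
\<close>

lemma non_loxodromic_conj_short:
  assumes P: "subsemigroup P"
    and non: "\<forall>f\<in>P. \<not> loxodromic f" and a: "a \<in> P" and b: "b \<in> P"
    and p: "p \<in> carrier G" "len p + len (inv p \<otimes> b) = len b"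
    and lower: "2 * len a + 3 * \<delta> < len p" and upper: "2 * len p \<le> len b - len a - 14 * \<delta>"
  shows "len (inv p \<otimes> (a \<otimes> p)) \<le> 24 * \<delta>"
proof -
  note PG = subsemigroup_subset[OF P]
  have aG: "a \<in> carrier G" and bG: "b \<in> carrier G" using a b PG by auto
  have a0: "0 \<le> len a" using aG by (rule len_nonneg)
  note pair = non_loxodromic_gp_pair[OF P non]
  have pb: "gp p b = len p" using p gp_double[of p b] by simp
  have "gp (inv p \<otimes> b) (inv p) = 0" using p bG gp_sym[of "inv p \<otimes> b" "inv p"] gp_prefix[of "inv p" b] pb by simp
  moreover have "gp (inv p) (inv p \<otimes> inv a) \<ge> len p - len a"
    using gp_prefix[of "inv p" "inv a"] gp_le_right[of p "inv a"] p aG by simp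
  ultimately have "gp (inv p \<otimes> b) (inv p \<otimes> inv a) \<le> 0 + \<delta>"
    using p aG bG lower a0 delta_nonneg by (intro gp_transfer[of _ "inv p"]) auto
  then have "gp (inv (a \<otimes> p)) (inv p \<otimes> b) \<le> \<delta>"
    using gp_sym[of "inv p \<otimes> b" "inv p \<otimes> inv a"] p aG bG by (simp add: inv_mult_group)
  moreover have "(a \<otimes> p) \<otimes> (inv p \<otimes> b) = a \<otimes> b" using p aG bG by (simp add: group_norm)
  ultimately have 1: "len (a \<otimes> p) - \<delta> \<le> gp (a \<otimes> p) (a \<otimes> b)"
    using gp_prefix[of "a \<otimes> p" "inv p \<otimes> b"] p aG bG by simp
  have "len b \<le> len a + len (a \<otimes> b)"
    using len_mult[of "inv a" "a \<otimes> b"] aG bG by (simp add: inv_mult_cancel_left)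
  then have 2: "len p \<le> gp (a \<otimes> b) b"
    using pair(2)[OF subsemigroup_mult[OF P a b] b] upper a0 by (auto simp: min_def split: if_splits)
  have "min (len (a \<otimes> p) - \<delta>) (len p) - \<delta> \<le> gp (a \<otimes> p) b"
    using gp_hyp[of "a \<otimes> p" "a \<otimes> b" b] 1 2 p aG bG by simp
  moreover have "gp b p = len p" using pb gp_sym p bG by simp
  ultimately have 3: "min (len (a \<otimes> p)) (len p) - 3 * \<delta> \<le> gp (a \<otimes> p) p"
    using gp_hyp[of "a \<otimes> p" b p] p aG bG delta_nonneg by (auto simp: min_def split: if_splits)
  have ab: "len a \<le> len b" using upper lower a0 delta_nonneg by argo
  have 4: "len (a \<otimes> p) \<le> len p + 14 * \<delta>"
  proof -
    have "len a / 2 - 7 * \<delta> \<le> gp (inv a) p"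
      using pair(1)[OF a b] ab gp_hyp[of "inv a" b p] \<open>gp b p = len p\<close> lower a0 delta_nonneg p aG bG
      by (auto simp: min_def split: if_splits)
    then show ?thesis using len_mult_gp[of a p] aG p by simp
  qed
  have 5: "len p \<le> len (a \<otimes> p) + 18 * \<delta>"
  proof -
    have "len a / 2 - 8 * \<delta> \<le> gp a p"
      using pair(2)[OF a b] ab gp_hyp[of a b p] \<open>gp b p = len p\<close> lower a0 delta_nonneg p aG bG
      by (auto simp: min_def split: if_splits)
    moreover have "len p - len a \<le> len (a \<otimes> p)"
      using len_mult[of "inv a" "a \<otimes> p"] aG p by (simp add: inv_mult_cancel_left)
    then have "len a / 2 - 8 * \<delta> \<le> gp p (a \<otimes> p)"
      using 3 gp_sym[of p "a \<otimes> p"] p aG lower a0 delta_nonneg by (auto simp: min_def split: if_splits)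
    ultimately have "len a / 2 - 9 * \<delta> \<le> gp a (a \<otimes> p)"
      using gp_hyp[of a p "a \<otimes> p"] p aG by (auto simp: min_def split: if_splits)
    then show ?thesis using len_diff_gp[of a "a \<otimes> p"] aG p by (simp add: inv_mult_cancel_left)
  qed
  show ?thesis
    using len_diff_gp[of p "a \<otimes> p"] gp_sym[of p "a \<otimes> p"] 3 4 5 delta_nonneg aG p
    by (auto simp: min_def split: if_splits)
qed

text \<open>
  Otherwise conjugation by one p sends more elements of P than a ball of radius
  \<open>24 * \<delta>\<close> contains into this ball.
\<close>

lemma exists_loxodromic:
  assumes P: "subsemigroup P" and inf: "infinite P"
  shows "\<exists>f\<in>P. loxodromic f"
proof (rule ccontr)
  note PG = subsemigroup_subset[OF P]
  assume "\<not> ?thesis"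
  then have non: "\<forall>f\<in>P. \<not> loxodromic f" by blast
  define B where "B = {x \<in> carrier G. len x \<le> 24 * \<delta>}"
  have finB: "finite B" unfolding B_def by (rule finite_ball)
  obtain F where F: "finite F" "card F = Suc (card B)" "F \<subseteq> P"
    using infinite_arbitrarily_large[OF inf] by blast
  define R where "R = Max (len ` F)"
  have R: "len a \<le> R" if "a \<in> F" for a using F that by (auto simp: R_def)
  have "F \<noteq> {}" using F by auto
  then have R0: "0 \<le> R" using R F PG len_nonneg by (meson ex_in_conv order_trans subsetD)
  obtain b where b: "b \<in> P" "6 * R + 20 * \<delta> + 2 < len b" using exists_long[OF inf PG] by blast
  have bG: "b \<in> carrier G" using b PG by blast
  define r where "r = (len b - R) / 2 - 7 * \<delta>"
  have r2: "2 * r = len b - R - 14 * \<delta>" by (simp add: r_def)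
  have r: "0 \<le> r" "r \<le> len b" "2 * R + 3 * \<delta> + 1 \<le> r" using b(2) R0 delta_nonneg len_nonneg[OF bG] r2 by - linarith+
  obtain p where p: "p \<in> carrier G" "len p + len (inv p \<otimes> b) = len b" "len p \<le> r" "r < len p + 1"
    using geodesic_prefix[OF bG r(1,2)] by blast
  define c where "c a = inv p \<otimes> (a \<otimes> p)" for a
  have "c ` F \<subseteq> B"
  proof
    fix y assume "y \<in> c ` F"
    then obtain a where a: "a \<in> F" "y = c a" by blast
    have "2 * len a + 3 * \<delta> < len p" "2 * len p \<le> len b - len a - 14 * \<delta>"
      using R[OF a(1)] p(3,4) r(3) r2 by - linarith+
    then have "len y \<le> 24 * \<delta>"
      unfolding a c_def using non_loxodromic_conj_short[OF P non _ b(1) p(1,2)] a F by blast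
    then show "y \<in> B" using a F PG p by (auto simp: B_def c_def)
  qed
  moreover have "inj_on c F"
  proof (rule inj_onI)
    fix x y assume "x \<in> F" "y \<in> F" "c x = c y"
    moreover have "x \<in> carrier G" "y \<in> carrier G" using calculation F PG by auto
    ultimately show "x = y" using p by (simp add: c_def)
  qed
  ultimately have "card F \<le> card B" using finB card_inj_on_le by blast
  then show False using F by simp
qed

end

section \<open>Sets with distinct products\<close>

context monoid
begin

abbreviation list_prod :: "'a list \<Rightarrow> 'a" where
  "list_prod w \<equiv> foldr (\<otimes>) w \<one>"

lemma list_prod_closed: "set w \<subseteq> carrier G \<Longrightarrow> list_prod w \<in> carrier G"
  by (induction w) auto

lemma list_prod_append:
  "set v \<subseteq> carrier G \<Longrightarrow> set w \<subseteq> carrier G \<Longrightarrow> list_prod (v @ w) = list_prod v \<otimes> list_prod w"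
  by (induction v) (auto simp: m_assoc list_prod_closed)

text \<open>
  Only words of equal length are compared: this is all that counting needs, and then a common first
  letter can be cancelled without changing the situation.
\<close>

definition free_on :: "'a set \<Rightarrow> bool" where
  "free_on Y \<longleftrightarrow> (\<forall>n. inj_on list_prod {w. set w \<subseteq> Y \<and> length w = n})"

end

context hyperbolic_length
begin

text \<open>
  Ping-pong in terms of Gromov products. The first two conditions make products of letters follow
  quasi-geodesics, so a product agrees with its first letter y up to about \<open>len y - K\<close>;
  by the third condition two different letters cannot both do so for the same product.
\<close>

lemma free_onI:
  assumes Y: "Y \<subseteq> carrier G" and K: "0 \<le> K"
    and turn: "\<And>y y'. y \<in> Y \<Longrightarrow> y' \<in> Y \<Longrightarrow> gp (inv y) y' \<le> K"
    and long: "\<And>y. y \<in> Y \<Longrightarrow> 2 * K + 2 * \<delta> < len y"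
    and apart: "\<And>y y'. y \<in> Y \<Longrightarrow> y' \<in> Y \<Longrightarrow> y \<noteq> y' \<Longrightarrow> gp y y' < min (len y) (len y') - K - 2 * \<delta>"
  shows "free_on Y"
proof -
  have YG: "list_prod w \<in> carrier G" if "set w \<subseteq> Y" for w
    using that Y by (intro list_prod_closed) auto
  have tail: "gp (inv y) (list_prod w) \<le> K + \<delta>" if "set w \<subseteq> Y" "y \<in> Y" for w y
    using that
  proof (induction w arbitrary: y)
    case Nil
    then show ?case using Y K delta_nonneg by auto
  next
    case (Cons z w)
    have G: "z \<in> carrier G" "y \<in> carrier G" "list_prod w \<in> carrier G" using Cons.prems Y YG by auto
    have "gp z (z \<otimes> list_prod w) \<ge> len z - (K + \<delta>)"
      using gp_prefix[OF G(1,3)] Cons.IH[of z] Cons.prems by simp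
    moreover have "2 * K + 2 * \<delta> < len z" using long[of z] Cons.prems by simp
    ultimately have "K + \<delta> < gp z (z \<otimes> list_prod w)" by linarith
    then have "gp (inv y) (z \<otimes> list_prod w) \<le> K + \<delta>"
      using turn[of y z] Cons.prems G by (intro gp_transfer[of _ z]) auto
    then show ?case by simp
  qed
  have "w = w'" if "length w = length w'" "set w \<subseteq> Y" "set w' \<subseteq> Y" "list_prod w = list_prod w'" for w w'
    using that
  proof (induction w w' rule: list_induct2)
    case Nil
    then show ?case by simp
  next
    case (Cons y w y' w')
    have G: "y \<in> carrier G" "y' \<in> carrier G" "list_prod w \<in> carrier G" "list_prod w' \<in> carrier G"
      using Cons.prems Y YG by auto
    have eq: "y \<otimes> list_prod w = y' \<otimes> list_prod w'" using Cons.prems by simp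
    define z where "z = y \<otimes> list_prod w"
    have zG: "z \<in> carrier G" using G by (simp add: z_def)
    have 1: "len y - (K + \<delta>) \<le> gp y z"
      using gp_prefix[OF G(1,3)] tail[of w y] Cons.prems by (simp add: z_def)
    have 2: "len y' - (K + \<delta>) \<le> gp z y'"
      using gp_prefix[OF G(2,4)] tail[of w' y'] Cons.prems gp_sym[OF zG G(2)] by (simp add: z_def eq)
    have "y = y'"
    proof (rule ccontr)
      assume "y \<noteq> y'"
      then have "gp y y' < min (len y) (len y') - K - 2 * \<delta>" using apart Cons.prems by simp
      then show False using 1 2 gp_hyp[OF G(1) zG G(2)] by linarith
    qed
    then have "list_prod w = list_prod w'" using eq G by simp
    then show ?case using Cons \<open>y = y'\<close> by simp
  qed
  then show ?thesis unfolding free_on_def by (intro allI inj_onI) auto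
qed

section \<open>Connectors\<close>

text \<open>
  The constant T may depend on u and u', but v and v' influence only how large n has to be. Later this
  allows bounds that do not grow when the connectors are made longer.
\<close>

lemma translates_diverge:
  assumes "loxodromic f" and u: "u \<in> carrier G" "u' \<in> carrier G" and not: "inv u \<otimes> u' \<notin> end_stab f"
  shows "\<exists>T. \<forall>v\<in>carrier G. \<forall>v'\<in>carrier G.
    \<forall>\<^sub>F n in sequentially. gp (u \<otimes> f [^] (n::nat) \<otimes> v) (u' \<otimes> f [^] n \<otimes> v') \<le> T"
proof -
  have f: "f \<in> carrier G" using assms by simp
  have "\<not> fellow f (inv u \<otimes> u')" using fellow_imp_end_stab(1)[OF assms(1)] u not by auto
  then obtain T where T: "\<And>N M. gp (f [^] (N::nat)) ((inv u \<otimes> u') \<otimes> f [^] (M::nat)) \<le> T"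
    unfolding fellow_def by (meson not_less)
  define c where "c = T + len u"
  have "\<forall>\<^sub>F n in sequentially. gp (u \<otimes> f [^] n \<otimes> v) (u' \<otimes> f [^] n \<otimes> v') \<le> c + \<delta> + \<delta>"
    if v: "v \<in> carrier G" "v' \<in> carrier G" for v v'
  proof -
    obtain n0 :: nat where n0: "\<And>n. n \<ge> n0 \<Longrightarrow> c + 2 * \<delta> + len u + len u' + len v + len v' < len (f [^] n)"
      using len_pow_unbounded[OF assms(1)] by blast
    have "gp (u \<otimes> f [^] n \<otimes> v) (u' \<otimes> f [^] n \<otimes> v') \<le> c + \<delta> + \<delta>" if "n \<ge> n0" for n
    proof -
      define x y where "x = u \<otimes> f [^] n" and "y = u' \<otimes> f [^] n"
      have G: "x \<in> carrier G" "y \<in> carrier G" using u f by (simp_all add: x_def y_def)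
      have nonneg: "0 \<le> len u" "0 \<le> len u'" "0 \<le> len v" "0 \<le> len v'" using u v len_nonneg by auto
      have "u \<otimes> ((inv u \<otimes> u') \<otimes> f [^] n) = y" using u f by (simp add: y_def group_norm)
      then have "gp y x \<le> c"
        using gp_translate[of u "f [^] n" "(inv u \<otimes> u') \<otimes> f [^] n"] T[of n n] u f gp_sym[OF G]
        by (simp add: c_def x_def)
      moreover have "len (f [^] n) \<le> len u + len x" "len (f [^] n) \<le> len u' + len y"
        using len_mult[of "inv u" x] len_mult[of "inv u'" y] u f
        by (simp_all add: x_def y_def inv_mult_cancel_left)
      moreover have "gp x (x \<otimes> v) \<ge> len x - len v" "gp y (y \<otimes> v') \<ge> len y - len v'"
        using gp_prefix gp_le_right[of "inv x" v] gp_le_right[of "inv y" v'] G v by simp_all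
      ultimately have big: "c + \<delta> < gp x (x \<otimes> v)" "c + \<delta> + \<delta> < gp y (y \<otimes> v')" and yx: "gp y x \<le> c"
        using n0[OF that] nonneg delta_nonneg by linarith+
      have "gp y (x \<otimes> v) \<le> c + \<delta>" by (rule gp_transfer[of y x]) (use G v yx big in auto)
      then have "gp (x \<otimes> v) y \<le> c + \<delta>" using gp_sym G v by simp
      then have "gp (x \<otimes> v) (y \<otimes> v') \<le> c + \<delta> + \<delta>"
        by (rule gp_transfer[rotated 3]) (use G v big in auto)
      then show ?thesis by (simp add: x_def y_def)
    qed
    then show ?thesis unfolding eventually_sequentially by blast
  qed
  then show ?thesis by blast
qed

lemma translates_diverge_uniform:
  assumes "loxodromic f" and U: "finite U" "U \<subseteq> carrier G" and V: "finite V" "V \<subseteq> carrier G"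
    and not: "\<And>u u'. u \<in> U \<Longrightarrow> u' \<in> U \<Longrightarrow> u \<noteq> u' \<Longrightarrow> inv u \<otimes> u' \<notin> end_stab f"
  shows "\<exists>T\<ge>0. \<forall>\<^sub>F n in sequentially. \<forall>u\<in>U. \<forall>u'\<in>U. \<forall>v\<in>V. \<forall>v'\<in>V. u \<noteq> u' \<longrightarrow>
    gp (u \<otimes> f [^] (n::nat) \<otimes> v) (u' \<otimes> f [^] n \<otimes> v') \<le> T"
proof -
  have "\<forall>u\<in>U. \<forall>u'\<in>U. \<exists>T. u \<noteq> u' \<longrightarrow> (\<forall>v\<in>carrier G. \<forall>v'\<in>carrier G.
    \<forall>\<^sub>F n in sequentially. gp (u \<otimes> f [^] (n::nat) \<otimes> v) (u' \<otimes> f [^] n \<otimes> v') \<le> T)"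
  proof (intro ballI)
    fix u u' assume "u \<in> U" "u' \<in> U"
    then have "u \<in> carrier G" "u' \<in> carrier G" "u \<noteq> u' \<Longrightarrow> inv u \<otimes> u' \<notin> end_stab f"
      using U(2) not by blast+
    then show "\<exists>T. u \<noteq> u' \<longrightarrow> (\<forall>v\<in>carrier G. \<forall>v'\<in>carrier G.
      \<forall>\<^sub>F n in sequentially. gp (u \<otimes> f [^] (n::nat) \<otimes> v) (u' \<otimes> f [^] n \<otimes> v') \<le> T)"
      using translates_diverge[OF assms(1), of u u'] by (cases "u = u'") simp_all
  qed
  then obtain T where T: "\<And>u u' v v'. u \<in> U \<Longrightarrow> u' \<in> U \<Longrightarrow> u \<noteq> u' \<Longrightarrow> v \<in> V \<Longrightarrow> v' \<in> V \<Longrightarrow>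
    \<forall>\<^sub>F n in sequentially. gp (u \<otimes> f [^] (n::nat) \<otimes> v) (u' \<otimes> f [^] n \<otimes> v') \<le> T u u'"
    using V(2) unfolding bchoice_iff subset_iff by blast
  define K where "K = Max (insert 0 ((\<lambda>(u, u'). T u u') ` (U \<times> U)))"
  have fin: "finite (insert 0 ((\<lambda>(u, u'). T u u') ` (U \<times> U)))" using U by simp
  have K: "T u u' \<le> K" if "u \<in> U" "u' \<in> U" for u u'
    unfolding K_def using that by (intro Max_ge[OF fin]) auto
  have "0 \<le> K" unfolding K_def by (intro Max_ge[OF fin]) auto
  moreover have "\<forall>\<^sub>F n in sequentially. \<forall>u\<in>U. \<forall>u'\<in>U. \<forall>v\<in>V. \<forall>v'\<in>V. u \<noteq> u' \<longrightarrow>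
    gp (u \<otimes> f [^] (n::nat) \<otimes> v) (u' \<otimes> f [^] n \<otimes> v') \<le> K"
  proof (intro eventually_ball_finite ballI U V)
    fix u u' v v' assume *: "u \<in> U" "u' \<in> U" "v \<in> V" "v' \<in> V"
    show "\<forall>\<^sub>F n in sequentially. u \<noteq> u' \<longrightarrow> gp (u \<otimes> f [^] (n::nat) \<otimes> v) (u' \<otimes> f [^] n \<otimes> v') \<le> K"
    proof (cases "u = u'")
      case False
      show ?thesis using T[OF *(1,2) False *(3,4)] K[OF *(1,2)] by (auto elim!: eventually_mono)
    qed simp
  qed
  ultimately show ?thesis by blast
qed

lemma eventually_long:
  assumes "loxodromic f" "u \<in> carrier G" "v \<in> carrier G"
  shows "\<forall>\<^sub>F n in sequentially. r < len (u \<otimes> f [^] (n::nat) \<otimes> v)"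
proof -
  have f: "f \<in> carrier G" using assms by simp
  obtain n0 :: nat where n0: "\<And>n. n \<ge> n0 \<Longrightarrow> r + len u + len v < len (f [^] n)"
    using len_pow_unbounded[OF assms(1)] by blast
  have "r < len (u \<otimes> f [^] n \<otimes> v)" if "n \<ge> n0" for n
  proof -
    have "f [^] n = inv u \<otimes> ((u \<otimes> f [^] n \<otimes> v) \<otimes> inv v)" using f assms by (simp add: group_norm)
    then have "len (f [^] n) \<le> len (inv u) + len ((u \<otimes> f [^] n \<otimes> v) \<otimes> inv v)"
      using len_mult[of "inv u" "(u \<otimes> f [^] n \<otimes> v) \<otimes> inv v"] f assms by simp
    also have "len ((u \<otimes> f [^] n \<otimes> v) \<otimes> inv v) \<le> len (u \<otimes> f [^] n \<otimes> v) + len (inv v)"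
      using f assms by (intro len_mult) auto
    finally show ?thesis using n0[OF that] assms by simp
  qed
  then show ?thesis unfolding eventually_sequentially by blast
qed

text \<open>
  The order of the quantifiers matters: K is fixed before the length r that the connectors have to
  exceed, since the required length depends on K.
\<close>

lemma connector_family:
  assumes "loxodromic f" and U: "finite U" "U \<subseteq> carrier G" and V: "finite V" "V \<subseteq> carrier G"
    and notU: "\<And>u u'. u \<in> U \<Longrightarrow> u' \<in> U \<Longrightarrow> u \<noteq> u' \<Longrightarrow> inv u \<otimes> u' \<notin> end_stab f"
    and notV: "\<And>v v'. v \<in> V \<Longrightarrow> v' \<in> V \<Longrightarrow> v \<noteq> v' \<Longrightarrow> v \<otimes> inv v' \<notin> end_stab f"
  shows "\<exists>K\<ge>0. \<forall>r. \<exists>n. \<forall>u\<in>U. \<forall>v\<in>V. r < len (u \<otimes> f [^] (n::nat) \<otimes> v) \<and>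
    (\<forall>u'\<in>U. \<forall>v'\<in>V.
      (u \<noteq> u' \<longrightarrow> gp (u \<otimes> f [^] n \<otimes> v) (u' \<otimes> f [^] n \<otimes> v') \<le> K) \<and>
      (v \<noteq> v' \<longrightarrow> gp (inv (u \<otimes> f [^] n \<otimes> v)) (inv (u' \<otimes> f [^] n \<otimes> v')) \<le> K))"
proof -
  have f: "f \<in> carrier G" using assms by simp
  obtain T1 where T1: "T1 \<ge> 0" "\<forall>\<^sub>F n in sequentially. \<forall>u\<in>U. \<forall>u'\<in>U. \<forall>v\<in>V. \<forall>v'\<in>V. u \<noteq> u' \<longrightarrow>
    gp (u \<otimes> f [^] (n::nat) \<otimes> v) (u' \<otimes> f [^] n \<otimes> v') \<le> T1"
    using translates_diverge_uniform[OF assms(1) U V notU] by blast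
  have "inv v \<otimes> v' \<notin> end_stab (inv f)" if *: "v \<in> m_inv G ` V" "v' \<in> m_inv G ` V" "v \<noteq> v'" for v v'
  proof -
    obtain x y where xy: "x \<in> V" "y \<in> V" "v = inv x" "v' = inv y" using * by blast
    then have "x \<noteq> y" using *(3) by blast
    then have "x \<otimes> inv y \<notin> end_stab f" using notV xy by blast
    moreover have "inv v = x" using xy V by auto
    ultimately show ?thesis using xy f by (simp add: end_stab_inv)
  qed
  moreover have "m_inv G ` V \<subseteq> carrier G" "m_inv G ` U \<subseteq> carrier G" using U V by auto
  ultimately obtain T2 where T2: "T2 \<ge> 0" "\<forall>\<^sub>F n in sequentially.
    \<forall>v\<in>m_inv G ` V. \<forall>v'\<in>m_inv G ` V. \<forall>u\<in>m_inv G ` U. \<forall>u'\<in>m_inv G ` U. v \<noteq> v' \<longrightarrow>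
    gp (v \<otimes> inv f [^] (n::nat) \<otimes> u) (v' \<otimes> inv f [^] n \<otimes> u') \<le> T2"
    using translates_diverge_uniform[OF loxodromic_inv[OF assms(1)], of "m_inv G ` V" "m_inv G ` U"] U V by blast
  have inv_eq: "inv (u \<otimes> f [^] n \<otimes> v) = inv v \<otimes> inv f [^] n \<otimes> inv u"
    if "u \<in> U" "v \<in> V" for u v and n :: nat
    using that U V f by (simp add: inv_mult_group nat_pow_inv m_assoc subset_iff)
  have inj: "inv v = inv v' \<Longrightarrow> v = v'" if "v \<in> V" "v' \<in> V" for v v'
    using that V by (metis inv_inv subsetD)
  show ?thesis
  proof (intro exI[of _ "max T1 T2"] conjI allI)
    show "0 \<le> max T1 T2" using T1 by simp
    fix r
    have "\<forall>\<^sub>F n in sequentially. \<forall>u\<in>U. \<forall>v\<in>V. r < len (u \<otimes> f [^] (n::nat) \<otimes> v)"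
      using U V by (intro eventually_ball_finite ballI eventually_long[OF assms(1)]) auto
    then have "\<forall>\<^sub>F n in sequentially. \<forall>u\<in>U. \<forall>v\<in>V. r < len (u \<otimes> f [^] (n::nat) \<otimes> v) \<and>
    (\<forall>u'\<in>U. \<forall>v'\<in>V.
      (u \<noteq> u' \<longrightarrow> gp (u \<otimes> f [^] n \<otimes> v) (u' \<otimes> f [^] n \<otimes> v') \<le> max T1 T2) \<and>
      (v \<noteq> v' \<longrightarrow> gp (inv (u \<otimes> f [^] n \<otimes> v)) (inv (u' \<otimes> f [^] n \<otimes> v')) \<le> max T1 T2))"
      using T1(2) T2(2)
    proof eventually_elim
      case (elim n)
      show ?case
      proof (intro ballI conjI impI)
        fix u v u' v' assume *: "u \<in> U" "v \<in> V" "u' \<in> U" "v' \<in> V"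
        show "r < len (u \<otimes> f [^] n \<otimes> v)" using elim(1) * by blast
        show "gp (u \<otimes> f [^] n \<otimes> v) (u' \<otimes> f [^] n \<otimes> v') \<le> max T1 T2" if "u \<noteq> u'"
        proof -
          have "gp (u \<otimes> f [^] n \<otimes> v) (u' \<otimes> f [^] n \<otimes> v') \<le> T1" using elim(2) * that by blast
          then show ?thesis by simp
        qed
        show "gp (inv (u \<otimes> f [^] n \<otimes> v)) (inv (u' \<otimes> f [^] n \<otimes> v')) \<le> max T1 T2" if "v \<noteq> v'"
        proof -
          have "gp (inv v \<otimes> inv f [^] n \<otimes> inv u) (inv v' \<otimes> inv f [^] n \<otimes> inv u') \<le> T2"
            using elim(3) * that inj by blast
          then show ?thesis using inv_eq * by simp
        qed
      qed
    qed
    then show "\<exists>n. \<forall>u\<in>U. \<forall>v\<in>V. r < len (u \<otimes> f [^] (n::nat) \<otimes> v) \<and>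
    (\<forall>u'\<in>U. \<forall>v'\<in>V.
      (u \<noteq> u' \<longrightarrow> gp (u \<otimes> f [^] n \<otimes> v) (u' \<otimes> f [^] n \<otimes> v') \<le> max T1 T2) \<and>
      (v \<noteq> v' \<longrightarrow> gp (inv (u \<otimes> f [^] n \<otimes> v)) (inv (u' \<otimes> f [^] n \<otimes> v')) \<le> max T1 T2))"
      by (rule eventually_happens'[OF sequentially_bot])
  qed
qed

lemma infinite_long:
  assumes "infinite A" "A \<subseteq> carrier G"
  shows "infinite {a \<in> A. r < len a}"
proof
  assume "finite {a \<in> A. r < len a}"
  moreover have "A \<subseteq> {a \<in> A. r < len a} \<union> {x \<in> carrier G. len x \<le> r}" using assms(2) by auto
  ultimately show False using assms(1) finite_ball finite_subset by blast
qed

text \<open>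
  Each element a of A gets one of the three connectors. At most one is spoiled by inv a; of the two
  others, every later element a' is spoiled by at most one, so one of them is good for infinitely
  many a', among which the selection continues. Since a' then turns away from a g(u) soon after
  passing a, the products a g(u) and a' g(u') agree only for about |a|, while |a g(u)|
  exceeds |a| by almost |g(u)|.
\<close>

lemma separated_products:
  fixes g :: "'i \<Rightarrow> 'a"
  assumes U: "card U = 3" and gU: "\<forall>u\<in>U. g u \<in> carrier G" and K: "0 \<le> K"
    and longU: "\<forall>u\<in>U. 4 * K + 5 * \<delta> < len (g u)"
    and uniqueU: "\<forall>x\<in>carrier G. \<forall>u\<in>U. \<forall>u'\<in>U. u \<noteq> u' \<longrightarrow> gp (g u) x \<le> K \<or> gp (g u') x \<le> K"
    and A: "infinite A" "A \<subseteq> carrier G"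
  shows "\<exists>Y. finite Y \<and> card Y = M \<and>
     (\<forall>y\<in>Y. \<exists>a\<in>A. \<exists>u\<in>U. y = a \<otimes> g u \<and> gp (g u) (inv a) \<le> K) \<and>
     (\<forall>y\<in>Y. \<forall>y'\<in>Y. y \<noteq> y' \<longrightarrow> gp y y' < min (len y) (len y') - (K + 2 * \<delta>) - 2 * \<delta>)"
  using A
proof (induction M arbitrary: A)
  case 0
  show ?case by (rule exI[of _ "{}"]) simp
next
  case (Suc M)
  note g = bspec[OF gU] and long = bspec[OF longU]
  have unique: "gp (g u) x \<le> K \<or> gp (g u') x \<le> K"
    if "x \<in> carrier G" "u \<in> U" "u' \<in> U" "u \<noteq> u'" for x u u'
    using uniqueU that by blast
  have AG: "a \<in> carrier G" if "a \<in> A" for a using that Suc.prems by blast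
  obtain a where a: "a \<in> A" using Suc.prems by (metis ex_in_conv finite.emptyI)
  have finU: "finite U" using U by (simp add: card_ge_0_finite)
  define bad where "bad = {u \<in> U. \<not> gp (g u) (inv a) \<le> K}"
  have fin: "finite bad" "finite (U - bad)" using finU by (auto simp: bad_def)
  have "\<forall>u\<in>bad. \<forall>u'\<in>bad. u = u'"
    using unique[of "inv a"] AG[OF a] by (auto simp: bad_def)
  then have "card bad \<le> Suc 0" using card_le_Suc0_iff_eq[OF fin(1)] by blast
  then have "\<not> card (U - bad) \<le> Suc 0"
    using U fin(1) card_Diff_subset[of bad U] by (auto simp: bad_def)
  then obtain u1 u2 where u: "u1 \<in> U - bad" "u2 \<in> U - bad" "u1 \<noteq> u2"
    using card_le_Suc0_iff_eq[OF fin(2)] by blast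
  define A' where "A' = {a' \<in> A. len a + 2 * K + \<delta> < len a'}"
  have "infinite A'" unfolding A'_def using infinite_long[OF Suc.prems] by simp
  moreover have "A' \<subseteq> {a' \<in> A'. gp (g u1) (inv a \<otimes> a') \<le> K} \<union> {a' \<in> A'. gp (g u2) (inv a \<otimes> a') \<le> K}"
  proof -
    have "gp (g u1) (inv a \<otimes> a') \<le> K \<or> gp (g u2) (inv a \<otimes> a') \<le> K" if "a' \<in> A'" for a'
    proof -
      have "a' \<in> carrier G" using that AG by (simp add: A'_def)
      then show ?thesis using unique[of "inv a \<otimes> a'" u1 u2] u AG[OF a] by simp
    qed
    then show ?thesis by blast
  qed
  ultimately have "infinite {a' \<in> A'. gp (g u1) (inv a \<otimes> a') \<le> K} \<or> infinite {a' \<in> A'. gp (g u2) (inv a \<otimes> a') \<le> K}"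
    using finite_subset[OF _ finite_UnI] by blast
  then obtain u where uU: "u \<in> U" and ua: "gp (g u) (inv a) \<le> K"
    and inf: "infinite {a' \<in> A'. gp (g u) (inv a \<otimes> a') \<le> K}"
    using u by (auto simp: bad_def)
  define B where "B = {a' \<in> A'. gp (g u) (inv a \<otimes> a') \<le> K}"
  have BA: "B \<subseteq> A" by (auto simp: B_def A'_def)
  obtain Y where Y: "finite Y" "card Y = M"
     "\<forall>y\<in>Y. \<exists>a\<in>B. \<exists>u\<in>U. y = a \<otimes> g u \<and> gp (g u) (inv a) \<le> K"
     "\<forall>y\<in>Y. \<forall>y'\<in>Y. y \<noteq> y' \<longrightarrow> gp y y' < min (len y) (len y') - (K + 2 * \<delta>) - 2 * \<delta>"
    using Suc.IH[of B] inf BA Suc.prems unfolding B_def by blast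
  define y where "y = a \<otimes> g u"
  have aG: "a \<in> carrier G" and gG: "g u \<in> carrier G" using AG[OF a] g[OF uU] by simp_all
  have yG: "y \<in> carrier G" using aG gG by (simp add: y_def)
  have leny: "len a + len (g u) - 2 * K \<le> len y"
    using len_mult_gp[OF aG gG] ua gp_sym[OF gG inv_closed[OF aG]] unfolding y_def by linarith
  have sep: "gp y y' < min (len y) (len y') - (K + 2 * \<delta>) - 2 * \<delta> \<and> y' \<in> carrier G" if y': "y' \<in> Y" for y'
  proof -
    obtain a' u' where a': "a' \<in> B" "u' \<in> U" "y' = a' \<otimes> g u'" "gp (g u') (inv a') \<le> K"
      using Y(3) y' by blast
    have G: "a' \<in> carrier G" "g u' \<in> carrier G" using a' BA AG g by auto
    have far: "len a + 2 * K + \<delta> < len a'" "gp (g u) (inv a \<otimes> a') \<le> K"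
      using a'(1) by (auto simp: B_def A'_def)
    have u'a: "gp (inv a') (g u') \<le> K" using a'(4) gp_sym[OF G(2) inv_closed[OF G(1)]] by linarith
    have "gp y a' \<le> len a + K"
      using gp_translate[OF aG gG, of "inv a \<otimes> a'"] far(2) aG G by (simp add: y_def mult_inv_cancel_left)
    moreover have "gp a' y' \<ge> len a' - K" using gp_prefix[OF G] u'a unfolding a'(3) by linarith
    ultimately have "gp y y' \<le> len a + K + \<delta>"
      using far(1) yG G a'(3) by (intro gp_transfer[of y a']) auto
    moreover have "len a' + len (g u') - 2 * K \<le> len y'"
      using len_mult_gp[OF G] u'a unfolding a'(3) by linarith
    ultimately show ?thesis
      using leny far(1) long[OF uU] long[OF a'(2)] K delta_nonneg G a'(3) by (auto simp: min_def)
  qed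
  have "gp y y = len y" using yG by (simp add: gp_def)
  then have "y \<notin> Y" using sep[of y] K delta_nonneg by auto
  show ?case
  proof (rule exI[of _ "insert y Y"], intro conjI ballI impI)
    show "finite (insert y Y)" "card (insert y Y) = Suc M" using Y \<open>y \<notin> Y\<close> by auto
    show "\<exists>a\<in>A. \<exists>u\<in>U. z = a \<otimes> g u \<and> gp (g u) (inv a) \<le> K" if "z \<in> insert y Y" for z
      using that Y(3) BA a uU ua y_def by blast
    show "gp z z' < min (len z) (len z') - (K + 2 * \<delta>) - 2 * \<delta>"
      if "z \<in> insert y Y" "z' \<in> insert y Y" "z \<noteq> z'" for z z'
      using that Y(4) sep yG gp_sym by (metis insertE min.commute)
  qed
qed

text \<open>
  The condition on the inverses of the connectors controls the turn between the end of one letter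
  a g(u) and the beginning of the next one.
\<close>

lemma free_products_with_connectors:
  fixes g :: "'i \<Rightarrow> 'a"
  assumes U: "card U = 3" and gU: "\<forall>u\<in>U. g u \<in> carrier G" and K: "0 \<le> K"
    and longU: "\<forall>u\<in>U. 4 * K + 5 * \<delta> < len (g u)"
    and uniqueU: "\<forall>x\<in>carrier G. \<forall>u\<in>U. \<forall>u'\<in>U. u \<noteq> u' \<longrightarrow> gp (g u) x \<le> K \<or> gp (g u') x \<le> K"
    and A: "infinite A" "A \<subseteq> carrier G"
    and turn: "\<And>a u. a \<in> A \<Longrightarrow> u \<in> U \<Longrightarrow> gp (inv (g u)) a \<le> K"
    and longA: "\<And>a. a \<in> A \<Longrightarrow> 2 * K + \<delta> < len a"
  shows "\<exists>Y. finite Y \<and> card Y = M \<and> Y \<subseteq> {a \<otimes> g u |a u. a \<in> A \<and> u \<in> U} \<and> free_on Y"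
proof -
  note g = bspec[OF gU] and long = bspec[OF longU]
  obtain Y where Y: "finite Y" "card Y = M"
     "\<forall>y\<in>Y. \<exists>a\<in>A. \<exists>u\<in>U. y = a \<otimes> g u \<and> gp (g u) (inv a) \<le> K"
     "\<forall>y\<in>Y. \<forall>y'\<in>Y. y \<noteq> y' \<longrightarrow> gp y y' < min (len y) (len y') - (K + 2 * \<delta>) - 2 * \<delta>"
    using separated_products[OF U gU K longU uniqueU A, where M = M] by blast
  have YG: "Y \<subseteq> carrier G"
  proof
    fix y assume "y \<in> Y"
    then obtain a u where "a \<in> A" "u \<in> U" "y = a \<otimes> g u" using Y(3) by blast
    then show "y \<in> carrier G" using A(2) g[of u] by auto
  qed
  have "free_on Y"
  proof (rule free_onI[OF YG, of "K + 2 * \<delta>"])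
    show "0 \<le> K + 2 * \<delta>" using K delta_nonneg by simp
    show "gp y y' < min (len y) (len y') - (K + 2 * \<delta>) - 2 * \<delta>" if "y \<in> Y" "y' \<in> Y" "y \<noteq> y'" for y y'
      using Y(4) that by simp
  next
    fix y assume "y \<in> Y"
    then obtain a u where y: "a \<in> A" "u \<in> U" "y = a \<otimes> g u" "gp (g u) (inv a) \<le> K" using Y(3) by blast
    have G: "a \<in> carrier G" "g u \<in> carrier G" using y(1,2) A(2) g[of u] by auto
    have "len y \<ge> len a + len (g u) - 2 * K"
      using len_mult_gp[OF G] y(4) gp_sym[OF G(2) inv_closed[OF G(1)]] unfolding y(3) by linarith
    then show "2 * (K + 2 * \<delta>) + 2 * \<delta> < len y"
      using long[OF y(2)] longA[OF y(1)] K delta_nonneg by argo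
    fix y' assume "y' \<in> Y"
    then obtain a' u' where y': "a' \<in> A" "u' \<in> U" "y' = a' \<otimes> g u'" "gp (g u') (inv a') \<le> K" using Y(3) by blast
    have G': "a' \<in> carrier G" "g u' \<in> carrier G" using y'(1,2) A(2) g[of u'] by auto
    have "gp a' y' \<ge> len a' - K"
      using gp_prefix[OF G'] y'(4) gp_sym[OF G'(2) inv_closed[OF G'(1)]] unfolding y'(3) by linarith
    then have "gp (inv (g u)) y' \<le> K + \<delta>"
      using turn[OF y'(1) y(2)] longA[OF y'(1)] G G' y'(3) by (intro gp_transfer[of _ a']) auto
    then have "gp y' (inv (g u)) \<le> K + \<delta>" using gp_sym G G' y'(3) by simp
    moreover have "gp (inv (g u)) (inv y) \<ge> len (g u) - K"
      using gp_prefix[of "inv (g u)" "inv a"] y(3,4) G by (simp add: inv_mult_group)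
    ultimately have "gp y' (inv y) \<le> K + \<delta> + \<delta>"
      using long[OF y(2)] K delta_nonneg G G' y(3) y'(3)
      by (intro gp_transfer[of y' "inv (g u)" "inv y" "K + \<delta>"]) auto
    then show "gp (inv y) y' \<le> K + 2 * \<delta>" using gp_sym[of y' "inv y"] G G' y(3) y'(3) by simp
  qed
  then show ?thesis using Y by blast
qed

lemma subsemigroup_mult_pow:
  assumes P: "subsemigroup P" and "u \<in> P" "f \<in> P"
  shows "u \<otimes> f [^] (n::nat) \<in> P"
proof (induction n)
  case 0
  show ?case using assms subsemigroup_subset[OF P] by auto
next
  case (Suc n)
  have "u \<otimes> f [^] Suc n = (u \<otimes> f [^] n) \<otimes> f"
    using assms subsemigroup_subset[OF P] by (simp add: m_assoc subset_iff)
  then show ?case using Suc subsemigroup_mult[OF P] assms by simp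
qed

lemma l_coset_eqI:
  assumes H: "subgroup H G" and u: "u \<in> carrier G" "u' \<in> carrier G" and "inv u \<otimes> u' \<in> H"
  shows "u <#\<^bsub>G\<^esub> H = u' <#\<^bsub>G\<^esub> H"
proof -
  have "u' = u \<otimes> (inv u \<otimes> u')" using u by (simp add: mult_inv_cancel_left)
  then have "u' \<in> u <#\<^bsub>G\<^esub> H" using assms(4) unfolding l_coset_def by blast
  then show ?thesis using l_repr_independence[OF _ u(1) H] by simp
qed

text \<open>
  The set of connectors is chosen before the size M, so that the elements of all the sets Y are
  composed of A and finitely many fixed elements of P.
\<close>

lemma free_or_virtually_cyclic:
  assumes P: "subsemigroup P" and A: "infinite A" "A \<subseteq> P"
    and not: "\<not> virtually_cyclic (G\<lparr>carrier := generate G P\<rparr>)"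
  shows "\<exists>\<Gamma>. finite \<Gamma> \<and> \<Gamma> \<subseteq> P \<and>
    (\<forall>M. \<exists>Y. finite Y \<and> card Y = M \<and> Y \<subseteq> {a \<otimes> g |a g. a \<in> A \<and> g \<in> \<Gamma>} \<and> free_on Y)"
proof -
  note PG = subsemigroup_subset[OF P]
  have "infinite P" using A finite_subset by blast
  then obtain f where f: "f \<in> P" "loxodromic f" using exists_loxodromic[OF P] by blast
  have fG: "f \<in> carrier G" using f by simp
  define H where "H = end_stab f"
  have H: "subgroup H G" unfolding H_def using subgroup_end_stab[OF fG] .
  have inf: "infinite ((\<lambda>u. u <#\<^bsub>G\<^esub> H) ` P)"
    using virtually_cyclic_of_finite_orbit[OF P f] not unfolding H_def by blast
  obtain Z where Z: "finite Z" "card Z = 3" "Z \<subseteq> (\<lambda>u. u <#\<^bsub>G\<^esub> H) ` P"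
    using infinite_arbitrarily_large[OF inf] by blast
  obtain U where U: "U \<subseteq> P" "inj_on (\<lambda>u. u <#\<^bsub>G\<^esub> H) U" "Z = (\<lambda>u. u <#\<^bsub>G\<^esub> H) ` U"
    using Z(3) unfolding subset_image_inj by blast
  have cardU: "card U = 3" using Z(2) U by (simp add: card_image)
  then have finU: "finite U" by (simp add: card_ge_0_finite)
  have UG: "U \<subseteq> carrier G" using U PG by blast
  have notU: "inv u \<otimes> u' \<notin> end_stab f" if "u \<in> U" "u' \<in> U" "u \<noteq> u'" for u u'
    using l_coset_eqI[OF H, of u u'] that U(2) UG unfolding H_def by (meson inj_onD subsetD)
  \<comment> \<open>Besides three left cosets, two elements in different right cosets are needed: f, which lies in
    H, and any element of P outside H.\<close>
  have "\<not> P \<subseteq> H"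
  proof
    assume "P \<subseteq> H"
    have "u <#\<^bsub>G\<^esub> H = \<one> <#\<^bsub>G\<^esub> H" if "u \<in> P" for u
      using l_coset_eqI[OF H, of \<one> u] that PG \<open>P \<subseteq> H\<close> by auto
    then have "(\<lambda>u. u <#\<^bsub>G\<^esub> H) ` P \<subseteq> {\<one> <#\<^bsub>G\<^esub> H}" by blast
    then show False using inf finite_subset by blast
  qed
  then obtain h where h: "h \<in> P" "h \<notin> H" by blast
  have hG: "h \<in> carrier G" using h PG by blast
  have fH: "f \<in> H" unfolding H_def using self_in_end_stab[OF fG] .
  have hf: "h \<otimes> inv f \<notin> H"
  proof
    assume "h \<otimes> inv f \<in> H"
    then have "(h \<otimes> inv f) \<otimes> f \<in> H" using fH subgroup.m_closed[OF H] by blast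
    then show False using h hG fG by (simp add: m_assoc)
  qed
  have fh: "f \<otimes> inv h \<notin> H"
  proof
    assume "f \<otimes> inv h \<in> H"
    then have "inv (f \<otimes> inv h) \<in> H" using subgroup.m_inv_closed[OF H] by blast
    then show False using hf hG fG by (simp add: inv_mult_group)
  qed
  define V where "V = {h, f}"
  have notV: "v \<otimes> inv v' \<notin> end_stab f" if "v \<in> V" "v' \<in> V" "v \<noteq> v'" for v v'
    using that hf fh by (auto simp: V_def H_def)
  have V: "finite V" "V \<subseteq> carrier G" using hG fG by (auto simp: V_def)
  obtain K0 where K0: "0 \<le> K0" and fam: "\<And>r. \<exists>n. \<forall>u\<in>U. \<forall>v\<in>V. r < len (u \<otimes> f [^] (n::nat) \<otimes> v) \<and>
    (\<forall>u'\<in>U. \<forall>v'\<in>V.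
      (u \<noteq> u' \<longrightarrow> gp (u \<otimes> f [^] n \<otimes> v) (u' \<otimes> f [^] n \<otimes> v') \<le> K0) \<and>
      (v \<noteq> v' \<longrightarrow> gp (inv (u \<otimes> f [^] n \<otimes> v)) (inv (u' \<otimes> f [^] n \<otimes> v')) \<le> K0))"
    using connector_family[OF f(2) finU UG V notU notV] by blast
  define K where "K = K0 + \<delta>"
  have K: "0 \<le> K" using K0 delta_nonneg by (simp add: K_def)
  obtain n where n: "\<forall>u\<in>U. \<forall>v\<in>V. 4 * K + 5 * \<delta> < len (u \<otimes> f [^] (n::nat) \<otimes> v) \<and>
    (\<forall>u'\<in>U. \<forall>v'\<in>V.
      (u \<noteq> u' \<longrightarrow> gp (u \<otimes> f [^] n \<otimes> v) (u' \<otimes> f [^] n \<otimes> v') \<le> K0) \<and>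
      (v \<noteq> v' \<longrightarrow> gp (inv (u \<otimes> f [^] n \<otimes> v)) (inv (u' \<otimes> f [^] n \<otimes> v')) \<le> K0))"
    using fam by blast
  define g where "g v u = u \<otimes> f [^] n \<otimes> v" for v u
  have VP: "V \<subseteq> P" using h f by (auto simp: V_def)
  have gP: "g v u \<in> P" if "u \<in> U" "v \<in> V" for u v
    unfolding g_def using that U VP f subsemigroup_mult[OF P] subsemigroup_mult_pow[OF P] by (meson subsetD)
  then have gG: "g v u \<in> carrier G" if "u \<in> U" "v \<in> V" for u v using that PG by blast
  have one_of: "gp x z \<le> K \<or> gp y z \<le> K"
    if "x \<in> carrier G" "y \<in> carrier G" "z \<in> carrier G" "gp x y \<le> K0" for x y z
    using gp_transfer[of x y z K0] that unfolding K_def by linarith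
  define good where "good v = {a \<in> A. \<forall>u\<in>U. gp (inv (g v u)) a \<le> K}" for v
  have "A \<subseteq> good h \<union> good f"
  proof
    fix a assume a: "a \<in> A"
    then have aG: "a \<in> carrier G" using A PG by blast
    have "h \<noteq> f" using h(2) fH by blast
    have "gp (inv (g h u)) a \<le> K \<or> gp (inv (g f u')) a \<le> K" if "u \<in> U" "u' \<in> U" for u u'
    proof (rule one_of)
      show "gp (inv (g h u)) (inv (g f u')) \<le> K0"
        using n that \<open>h \<noteq> f\<close> by (auto simp: g_def V_def)
    qed (use gG that aG in \<open>auto simp: V_def\<close>)
    then show "a \<in> good h \<union> good f" using a by (auto simp: good_def)
  qed
  then obtain v where v: "v \<in> V" "infinite (good v)"
    using A(1) finite_subset[OF _ finite_UnI] by (metis V_def insertCI)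
  define B where "B = {a \<in> good v. 2 * K + \<delta> < len a}"
  have goodG: "good v \<subseteq> carrier G" using A PG by (auto simp: good_def)
  have B: "infinite B" "B \<subseteq> carrier G" unfolding B_def using infinite_long[OF v(2) goodG] goodG by auto
  have BA: "B \<subseteq> A" by (auto simp: B_def good_def)
  have ex: "\<exists>Y. finite Y \<and> card Y = M \<and> Y \<subseteq> {a \<otimes> g v u |a u. a \<in> B \<and> u \<in> U} \<and> free_on Y" for M
  proof (rule free_products_with_connectors[OF cardU _ K _ _ B])
    show "\<forall>u\<in>U. g v u \<in> carrier G" using gG v by blast
    show "\<forall>u\<in>U. 4 * K + 5 * \<delta> < len (g v u)" using n v(1) unfolding g_def by blast
    show "\<forall>x\<in>carrier G. \<forall>u\<in>U. \<forall>u'\<in>U. u \<noteq> u' \<longrightarrow> gp (g v u) x \<le> K \<or> gp (g v u') x \<le> K"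
    proof (intro ballI impI one_of)
      show "gp (g v u) (g v u') \<le> K0" if "u \<in> U" "u' \<in> U" "u \<noteq> u'" for u u'
        using n v(1) that unfolding g_def by blast
    qed (use gG v in auto)
    show "gp (inv (g v u)) a \<le> K" if "a \<in> B" "u \<in> U" for a u using that by (auto simp: B_def good_def)
    show "2 * K + \<delta> < len a" if "a \<in> B" for a using that by (auto simp: B_def)
  qed
  have "\<forall>M. \<exists>Y. finite Y \<and> card Y = M \<and> Y \<subseteq> {a \<otimes> c |a c. a \<in> A \<and> c \<in> g v ` U} \<and> free_on Y"
  proof (intro allI)
    fix M
    obtain Y where "finite Y" "card Y = M" "Y \<subseteq> {a \<otimes> g v u |a u. a \<in> B \<and> u \<in> U}" "free_on Y"
      using ex[of M] by blast
    moreover have "{a \<otimes> g v u |a u. a \<in> B \<and> u \<in> U} \<subseteq> {a \<otimes> c |a c. a \<in> A \<and> c \<in> g v ` U}"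
      using BA by blast
    ultimately show "\<exists>Y. finite Y \<and> card Y = M \<and> Y \<subseteq> {a \<otimes> c |a c. a \<in> A \<and> c \<in> g v ` U} \<and> free_on Y"
      by blast
  qed
  then show ?thesis using finU gP v by (intro exI[of _ "g v ` U"]) auto
qed

end

section \<open>Word metrics\<close>

locale word_metric = group G for G (structure) +
  fixes S :: "'a set"
  assumes generating: "finite_generating_set G S"
begin

abbreviation wl :: "'a \<Rightarrow> nat" where
  "wl \<equiv> word_length G S"

definition letters :: "'a set" where
  "letters = S \<union> m_inv G ` S"

lemma S_subset: "S \<subseteq> carrier G" and finite_S: "finite S" and generate_S: "generate G S = carrier G"
  using generating by (auto simp: finite_generating_set_def)

lemma letters_subset: "letters \<subseteq> carrier G"
  using S_subset by (auto simp: letters_def)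

lemma finite_letters: "finite letters"
  using finite_S by (simp add: letters_def)

lemma inv_letters: "x \<in> letters \<Longrightarrow> inv x \<in> letters"
  using S_subset by (auto simp: letters_def)

lemma word_closed: "set w \<subseteq> letters \<Longrightarrow> list_prod w \<in> carrier G"
  using letters_subset by (intro list_prod_closed) auto

lemma list_prod_rev_inv:
  "set w \<subseteq> carrier G \<Longrightarrow> list_prod (rev (map (m_inv G) w)) = inv (list_prod w)"
proof (induction w)
  case (Cons x w)
  have "set (rev (map (m_inv G) w)) \<subseteq> carrier G" "set [inv x] \<subseteq> carrier G" using Cons.prems by auto
  then have "list_prod (rev (map (m_inv G) w) @ [inv x]) = inv (list_prod w) \<otimes> inv x"
    using Cons by (subst list_prod_append) auto
  then show ?case using Cons.prems list_prod_closed[of w] by (simp add: inv_mult_group)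
qed simp

lemma word_exists:
  assumes "g \<in> carrier G"
  shows "\<exists>w. set w \<subseteq> letters \<and> list_prod w = g"
proof -
  have "g \<in> generate G S" using assms generate_S by simp
  then show ?thesis
  proof (induction rule: generate.induct)
    case one
    show ?case by (rule exI[of _ "[]"]) simp
  next
    case (incl h)
    then show ?case using S_subset by (intro exI[of _ "[h]"]) (auto simp: letters_def)
  next
    case (inv h)
    then show ?case using S_subset by (intro exI[of _ "[inv h]"]) (auto simp: letters_def)
  next
    case (eng h1 h2)
    then obtain v w where vw: "set v \<subseteq> letters" "list_prod v = h1" "set w \<subseteq> letters" "list_prod w = h2" by blast
    then have "list_prod (v @ w) = h1 \<otimes> h2" using letters_subset list_prod_append[of v w] by blast
    then show ?case using vw by (intro exI[of _ "v @ w"]) auto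
  qed
qed

lemma wl_le: "set w \<subseteq> letters \<Longrightarrow> wl (list_prod w) \<le> length w"
  unfolding word_length_def letters_def by (rule Least_le) blast

lemma wl_witness:
  assumes "g \<in> carrier G"
  shows "\<exists>w. length w = wl g \<and> set w \<subseteq> letters \<and> list_prod w = g"
proof -
  have "\<exists>n w. length w = n \<and> set w \<subseteq> S \<union> m_inv G ` S \<and> list_prod w = g"
    using word_exists[OF assms] unfolding letters_def by blast
  then show ?thesis unfolding word_length_def letters_def by (rule LeastI_ex)
qed

lemma wl_one [simp]: "wl \<one> = 0"
  using wl_le[of "[]"] by simp

lemma wl_mult:
  assumes "g \<in> carrier G" "h \<in> carrier G"
  shows "wl (g \<otimes> h) \<le> wl g + wl h"
proof -
  obtain v where v: "length v = wl g" "set v \<subseteq> letters" "list_prod v = g"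
    using wl_witness[OF assms(1)] by blast
  obtain w where w: "length w = wl h" "set w \<subseteq> letters" "list_prod w = h"
    using wl_witness[OF assms(2)] by blast
  have "list_prod (v @ w) = g \<otimes> h" using v w letters_subset by (subst list_prod_append) auto
  then show ?thesis using wl_le[of "v @ w"] v w by simp
qed

lemma wl_inv_le:
  assumes "g \<in> carrier G"
  shows "wl (inv g) \<le> wl g"
proof -
  obtain w where w: "length w = wl g" "set w \<subseteq> letters" "list_prod w = g"
    using wl_witness[OF assms] by blast
  have "set (rev (map (m_inv G) w)) \<subseteq> letters" using w inv_letters by auto
  moreover have "list_prod (rev (map (m_inv G) w)) = inv g"
    using w letters_subset list_prod_rev_inv[of w] by auto
  ultimately show ?thesis using wl_le[of "rev (map (m_inv G) w)"] w by simp
qed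

lemma wl_inv: "g \<in> carrier G \<Longrightarrow> wl (inv g) = wl g"
  using wl_inv_le[of g] wl_inv_le[of "inv g"] by simp

lemma finite_wl_ball: "finite {g \<in> carrier G. wl g \<le> n}"
proof (rule finite_subset)
  show "{g \<in> carrier G. wl g \<le> n} \<subseteq> list_prod ` {w. set w \<subseteq> letters \<and> length w \<le> n}"
  proof
    fix g assume g: "g \<in> {g \<in> carrier G. wl g \<le> n}"
    then obtain w where "length w = wl g" "set w \<subseteq> letters" "list_prod w = g" using wl_witness[of g] by blast
    then show "g \<in> list_prod ` {w. set w \<subseteq> letters \<and> length w \<le> n}" using g by force
  qed
qed (intro finite_imageI finite_lists_length_le finite_letters)

lemma wl_prefix:
  assumes g: "g \<in> carrier G" and k: "k \<le> wl g"
  shows "\<exists>p\<in>carrier G. wl p = k \<and> wl p + wl (inv p \<otimes> g) = wl g"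
proof -
  obtain w where w: "length w = wl g" "set w \<subseteq> letters" "list_prod w = g"
    using wl_witness[OF g] by blast
  define p q where "p = list_prod (take k w)" and "q = list_prod (drop k w)"
  have sets: "set (take k w) \<subseteq> letters" "set (drop k w) \<subseteq> letters"
    using w set_take_subset[of k w] set_drop_subset[of k w] by auto
  then have G: "p \<in> carrier G" "q \<in> carrier G" unfolding p_def q_def using word_closed by auto
  have "list_prod (take k w @ drop k w) = p \<otimes> q"
    unfolding p_def q_def using sets letters_subset by (intro list_prod_append) auto
  then have "g = p \<otimes> q" using w by simp
  then have q: "inv p \<otimes> g = q" using G by (simp add: inv_mult_cancel_left)
  have "wl p \<le> k" "wl q \<le> wl g - k"
    unfolding p_def q_def using wl_le[OF sets(1)] wl_le[OF sets(2)] w by auto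
  moreover have "wl g \<le> wl p + wl q" using wl_mult[OF G] \<open>g = p \<otimes> q\<close> by simp
  ultimately have "wl p = k" "wl p + wl q = wl g" using k by linarith+
  then show ?thesis using G q by auto
qed

lemma word_dist_one: "g \<in> carrier G \<Longrightarrow> word_dist G S \<one> g = wl g"
  by (simp add: word_dist_def)

lemma word_ball_eq: "word_ball G S n = {g \<in> carrier G. wl g \<le> n}"
  by (auto simp: word_ball_def word_dist_one)

lemma gromov_hyperbolic_imp_hyperbolic_length:
  assumes "gromov_hyperbolic (carrier G) (word_dist G S)"
  shows "\<exists>\<delta>. hyperbolic_length G (\<lambda>x. real (wl x)) \<delta>"
proof -
  obtain \<delta> where \<delta>: "0 \<le> \<delta>" and hyp: "\<forall>e\<in>carrier G. \<forall>x\<in>carrier G. \<forall>y\<in>carrier G. \<forall>z\<in>carrier G.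
      gromov_product (word_dist G S) e x z \<ge>
      min (gromov_product (word_dist G S) e x y) (gromov_product (word_dist G S) e y z) - \<delta>"
    using assms unfolding gromov_hyperbolic_def by blast
  have gp: "gromov_product (word_dist G S) \<one> x y = (real (wl x) + real (wl y) - real (wl (inv x \<otimes> y))) / 2"
    if "x \<in> carrier G" "y \<in> carrier G" for x y
    using that by (simp add: gromov_product_def word_dist_one) (simp add: word_dist_def)
  have "hyperbolic_length G (\<lambda>x. real (wl x)) \<delta>"
  proof
    show "0 \<le> \<delta>" by (rule \<delta>)
    show "real (wl \<one>) = 0" by simp
    show "real (wl (inv x)) = real (wl x)" if "x \<in> carrier G" for x using wl_inv[OF that] by simp
    show "real (wl (x \<otimes> y)) \<le> real (wl x) + real (wl y)" if "x \<in> carrier G" "y \<in> carrier G" for x y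
      using wl_mult[OF that] by linarith
    show "finite {x \<in> carrier G. real (wl x) \<le> r}" for r
      by (rule finite_subset[OF _ finite_wl_ball[of "nat \<lfloor>r\<rfloor>"]]) (auto simp: le_nat_floor)
    show "\<exists>p\<in>carrier G. real (wl p) + real (wl (inv p \<otimes> x)) = real (wl x) \<and> real (wl p) \<le> r \<and> r < real (wl p) + 1"
      if x: "x \<in> carrier G" and r: "0 \<le> r" "r \<le> real (wl x)" for x r
    proof -
      have k: "nat \<lfloor>r\<rfloor> \<le> wl x" "real (nat \<lfloor>r\<rfloor>) \<le> r" "r < real (nat \<lfloor>r\<rfloor>) + 1" using r by linarith+
      obtain p where p: "p \<in> carrier G" "wl p = nat \<lfloor>r\<rfloor>" "wl p + wl (inv p \<otimes> x) = wl x"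
        using wl_prefix[OF x k(1)] by blast
      have "real (wl p) + real (wl (inv p \<otimes> x)) = real (wl x)" using p(3) by linarith
      then show ?thesis using p(1) k(2,3) unfolding p(2)[symmetric] by blast
    qed
    show "min ((real (wl x) + real (wl y) - real (wl (inv x \<otimes> y))) / 2)
              ((real (wl y) + real (wl z) - real (wl (inv y \<otimes> z))) / 2) - \<delta>
           \<le> (real (wl x) + real (wl z) - real (wl (inv x \<otimes> z))) / 2"
      if xyz: "x \<in> carrier G" "y \<in> carrier G" "z \<in> carrier G" for x y z
      using hyp[rule_format, OF one_closed xyz] unfolding gp[OF xyz(1,2)] gp[OF xyz(2,3)] gp[OF xyz(1,3)] .
  qed
  then show ?thesis by blast
qed

lemma wl_list_prod_le:
  assumes "set w \<subseteq> Z" "Z \<subseteq> carrier G" "\<And>z. z \<in> Z \<Longrightarrow> wl z \<le> l"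
  shows "wl (list_prod w) \<le> length w * l"
  using assms(1)
proof (induction w)
  case (Cons z w)
  have "list_prod w \<in> carrier G" using Cons.prems assms(2) by (intro list_prod_closed) auto
  then have "wl (z \<otimes> list_prod w) \<le> wl z + wl (list_prod w)"
    using Cons.prems assms(2) by (intro wl_mult) auto
  also have "\<dots> \<le> l + length w * l" using Cons assms(3)[of z] by (intro add_mono) auto
  finally show ?case by simp
qed simp

text \<open>
  Comparing balls of arbitrary radius n with those of radius a multiple of R costs one multiple, and
  the shift from m to \<open>Suc m\<close> another one; both are harmless once \<open>4 * R \<le> n\<close>.
\<close>

lemma positive_growthI:
  assumes "0 < R" and count: "\<And>m. 2 ^ m \<le> card (A \<inter> word_ball G S (R * Suc m))"
  shows "positive_exponential_growth G S A"
proof -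
  define c where "c = ln 2 / (2 * real R)"
  have c: "0 < c" using assms(1) by (simp add: c_def)
  have "c \<le> 1 / real n * ln (real (card (A \<inter> word_ball G S n)))" if n: "4 * R \<le> n" for n
  proof -
    define m where "m = n div R - 1"
    have "4 \<le> n div R" using n assms(1) by (simp add: less_eq_div_iff_mult_less_eq)
    then have m: "Suc m = n div R" by (simp add: m_def)
    have "R * Suc m \<le> n" unfolding m by simp
    then have "A \<inter> word_ball G S (R * Suc m) \<subseteq> A \<inter> word_ball G S n" by (auto simp: word_ball_eq)
    moreover have "finite (A \<inter> word_ball G S n)" using finite_wl_ball by (simp add: word_ball_eq)
    ultimately have "2 ^ m \<le> card (A \<inter> word_ball G S n)" using count[of m] card_mono by (meson le_trans)
    then have "(2::real) ^ m \<le> real (card (A \<inter> word_ball G S n))"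
      by (metis of_nat_le_iff of_nat_numeral of_nat_power)
    then have "ln ((2::real) ^ m) \<le> ln (real (card (A \<inter> word_ball G S n)))"
      by (subst ln_le_cancel_iff) (auto intro: less_le_trans[of _ "2 ^ m"])
    then have ln: "real m * ln 2 \<le> ln (real (card (A \<inter> word_ball G S n)))" by (simp add: ln_realpow)
    have "n < R * Suc (n div R)" using dividend_less_times_div[OF assms(1), of n] by simp
    then have "n < R * (m + 2)" using m by simp
    then have "n \<le> 2 * (R * m)" using n by (simp add: algebra_simps)
    then have "real n \<le> 2 * real R * real m" by (metis mult.assoc of_nat_le_iff of_nat_mult of_nat_numeral)
    then have "real n * c \<le> real m * ln 2"
      using assms(1) mult_right_mono[of "real n" "2 * real R * real m" "ln 2"] by (simp add: c_def field_simps)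
    then have "real n * c \<le> ln (real (card (A \<inter> word_ball G S n)))" using ln by linarith
    moreover have "0 < real n" using n assms(1) by simp
    ultimately show ?thesis by (simp add: field_simps)
  qed
  then have "\<forall>\<^sub>F n in sequentially. ereal c \<le> ereal (1 / real n * ln (real (card (A \<inter> word_ball G S n))))"
    unfolding eventually_sequentially by (intro exI[of _ "4 * R"]) simp
  then have "ereal c \<le> liminf (\<lambda>n. ereal (1 / real n * ln (real (card (A \<inter> word_ball G S n)))))"
    by (rule Liminf_bounded)
  then show ?thesis
    unfolding positive_exponential_growth_def using c by (meson ereal_less(2) less_le_trans)
qed

end

section \<open>Approximate semigroups\<close>

context group
begin

definition thicken :: "'a set \<Rightarrow> 'a set \<Rightarrow> nat \<Rightarrow> 'a set" where
  "thicken A F i = {a \<otimes> list_prod x |a x. a \<in> A \<and> set x \<subseteq> F \<and> length x = i}"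

text \<open>
  Left multiplication by y sends A F^i into A F^(i+k) for all i. If A A is contained in A F, this
  holds for the elements of A with k = 1, and unlike membership in A it passes to products.
\<close>

definition absorbs :: "'a set \<Rightarrow> 'a set \<Rightarrow> nat \<Rightarrow> 'a \<Rightarrow> bool" where
  "absorbs A F k y \<longleftrightarrow> (\<forall>i. \<forall>z\<in>thicken A F i. y \<otimes> z \<in> thicken A F (i + k))"

lemma thicken_subset: "A \<subseteq> carrier G \<Longrightarrow> F \<subseteq> carrier G \<Longrightarrow> thicken A F i \<subseteq> carrier G"
  by (auto simp: thicken_def intro!: m_closed list_prod_closed)

lemma thicken_mono:
  assumes "F \<subseteq> carrier G" "\<one> \<in> F" "i \<le> j"
  shows "thicken A F i \<subseteq> thicken A F j"
  using assms(3)
proof (induction rule: dec_induct)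
  case (step j)
  have "thicken A F j \<subseteq> thicken A F (Suc j)"
  proof
    fix z assume "z \<in> thicken A F j"
    then obtain a x where ax: "a \<in> A" "set x \<subseteq> F" "length x = j" "z = a \<otimes> list_prod x"
      by (auto simp: thicken_def)
    have "list_prod x \<in> carrier G" using ax assms(1) by (intro list_prod_closed) auto
    then have "z = a \<otimes> list_prod (\<one> # x)" using ax by simp
    moreover have "set (\<one> # x) \<subseteq> F" "length (\<one> # x) = Suc j" using ax assms(2) by auto
    ultimately show "z \<in> thicken A F (Suc j)" using ax(1) unfolding thicken_def by blast
  qed
  then show ?case using step by blast
qed simp

lemma absorbs_mono:
  "F \<subseteq> carrier G \<Longrightarrow> \<one> \<in> F \<Longrightarrow> k \<le> l \<Longrightarrow> absorbs A F k y \<Longrightarrow> absorbs A F l y"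
  unfolding absorbs_def using thicken_mono[of F] by (meson add_left_mono subsetD)

lemma absorbs_mult:
  assumes "A \<subseteq> carrier G" "F \<subseteq> carrier G" "y \<in> carrier G" "z \<in> carrier G"
    and y: "absorbs A F k y" and z: "absorbs A F l z"
  shows "absorbs A F (k + l) (y \<otimes> z)"
  unfolding absorbs_def
proof (intro allI ballI)
  fix i t assume t: "t \<in> thicken A F i"
  then have "y \<otimes> (z \<otimes> t) \<in> thicken A F ((i + l) + k)"
    using y z unfolding absorbs_def by blast
  moreover have "t \<in> carrier G" using t thicken_subset[OF assms(1,2)] by blast
  ultimately show "(y \<otimes> z) \<otimes> t \<in> thicken A F (i + (k + l))"
    using assms by (simp add: m_assoc ac_simps)
qed

lemma absorbs_self:
  assumes A: "A \<subseteq> carrier G" and F: "F \<subseteq> carrier G" and AA: "A <#> A \<subseteq> A <#> F" and a: "a \<in> A"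
  shows "absorbs A F 1 a"
  unfolding absorbs_def
proof (intro allI ballI)
  fix i t assume "t \<in> thicken A F i"
  then obtain b x where b: "b \<in> A" "set x \<subseteq> F" "length x = i" "t = b \<otimes> list_prod x"
    by (auto simp: thicken_def)
  have "a \<otimes> b \<in> A <#> A" using a b unfolding set_mult_def by blast
  then have "a \<otimes> b \<in> A <#> F" using AA by blast
  then obtain c s where c: "c \<in> A" "s \<in> F" "a \<otimes> b = c \<otimes> s" unfolding set_mult_def by blast
  have "list_prod x \<in> carrier G" using b F by (intro list_prod_closed) auto
  moreover have "a \<in> carrier G" "b \<in> carrier G" "c \<in> carrier G" "s \<in> carrier G" using a b c A F by auto
  ultimately have "a \<otimes> t = c \<otimes> list_prod (s # x)"
    using b(4) c(3) by (simp add: m_assoc[symmetric])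
  moreover have "set (s # x) \<subseteq> F" "length (s # x) = i + 1" using b c by auto
  ultimately show "a \<otimes> t \<in> thicken A F (i + 1)" using c(1) unfolding thicken_def by blast
qed

lemma absorbs_list_prod:
  assumes "A \<subseteq> carrier G" "F \<subseteq> carrier G" "Y \<subseteq> carrier G" "\<forall>y\<in>Y. absorbs A F k y"
    and a: "a \<in> A" and "set w \<subseteq> Y"
  shows "list_prod w \<otimes> a \<in> thicken A F (length w * k)"
  using assms(6)
proof (induction w)
  case Nil
  have "a \<otimes> list_prod [] = \<one> \<otimes> a" using a assms(1) by auto
  then show ?case using a unfolding thicken_def by force
next
  case (Cons y w)
  have G: "y \<in> carrier G" "list_prod w \<in> carrier G" "a \<in> carrier G"
    using Cons.prems assms by (auto intro!: list_prod_closed)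
  have "absorbs A F k y" using Cons.prems assms(4) by simp
  moreover have "list_prod w \<otimes> a \<in> thicken A F (length w * k)" using Cons by simp
  ultimately have "y \<otimes> (list_prod w \<otimes> a) \<in> thicken A F (length w * k + k)"
    unfolding absorbs_def by blast
  then show ?case using G by (simp add: m_assoc add.commute)
qed

end

context word_metric
begin

text \<open>
  The products of words of length m, applied to a base point in A, are \<open>(2 * card F ^ k) ^ m\<close>
  distinct elements, each obtained from an element of A of length linear in m by right
  multiplication with one of at most \<open>(card F ^ k) ^ m\<close> products of elements of F.
\<close>

lemma positive_growth_of_free:
  assumes A: "A \<subseteq> carrier G" and F: "F \<subseteq> carrier G" "finite F" "\<one> \<in> F"
    and Y: "Y \<subseteq> carrier G" "finite Y" "card Y = 2 * card F ^ k"
    and absorb: "\<forall>y\<in>Y. absorbs A F k y" and free: "free_on Y" and a0: "a0 \<in> A"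
  shows "positive_exponential_growth G S A"
proof -
  define lF lY R where "lF = Max (wl ` F)" and "lY = Max (wl ` Y)" and "R = lY + k * lF + wl a0 + 1"
  have lF: "wl x \<le> lF" if "x \<in> F" for x using F that by (simp add: lF_def)
  have lY: "wl y \<le> lY" if "y \<in> Y" for y using Y that by (simp add: lY_def)
  have cF: "0 < card F" using F by (auto simp: card_gt_0_iff)
  have "2 ^ m \<le> card (A \<inter> word_ball G S (R * Suc m))" for m
  proof -
    define B where "B = A \<inter> word_ball G S (R * Suc m)"
    have finB: "finite B" unfolding B_def using finite_wl_ball by (simp add: word_ball_eq)
    define L where "L = {w. set w \<subseteq> Y \<and> length w = m}"
    define T where "T = {x. set x \<subseteq> F \<and> length x = m * k}"
    have finT: "finite T" unfolding T_def using finite_lists_length_eq[OF F(2)] .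
    define \<phi> where "\<phi> w = list_prod w \<otimes> a0" for w
    have a0G: "a0 \<in> carrier G" using a0 A by blast
    have wG: "list_prod w \<in> carrier G" if "w \<in> L" for w
      using that Y(1) unfolding L_def by (intro list_prod_closed) auto
    have "inj_on \<phi> L"
    proof (rule inj_onI)
      fix v w assume vw: "v \<in> L" "w \<in> L" "\<phi> v = \<phi> w"
      then have "list_prod v = list_prod w" using wG a0G by (simp add: \<phi>_def)
      then show "v = w" using free vw unfolding free_on_def L_def by (meson inj_onD)
    qed
    then have "card (\<phi> ` L) = (2 * card F ^ k) ^ m"
      using card_image card_lists_length_eq[OF Y(2), of m] Y(3) unfolding L_def by fastforce
    moreover have "\<phi> ` L \<subseteq> (\<lambda>(a, x). a \<otimes> list_prod x) ` (B \<times> T)"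
    proof
      fix z assume "z \<in> \<phi> ` L"
      then obtain w where w: "w \<in> L" "z = list_prod w \<otimes> a0" by (auto simp: \<phi>_def)
      have "z \<in> thicken A F (m * k)"
        using absorbs_list_prod[OF A F(1) Y(1) absorb a0, of w] w by (simp add: L_def)
      then obtain a x where ax: "a \<in> A" "x \<in> T" "z = a \<otimes> list_prod x"
        by (auto simp: thicken_def T_def)
      have aG: "a \<in> carrier G" using ax A by blast
      have xG: "list_prod x \<in> carrier G" using ax F(1) unfolding T_def by (intro list_prod_closed) auto
      have zG: "z \<in> carrier G" using ax aG xG by simp
      have "a = z \<otimes> inv (list_prod x)" using ax aG xG by (simp add: m_assoc)
      then have "wl a \<le> wl z + wl (list_prod x)"
        using wl_mult[OF zG inv_closed[OF xG]] wl_inv[OF xG] by simp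
      also have "wl z \<le> wl (list_prod w) + wl a0" unfolding w(2) using wl_mult wG[OF w(1)] a0G by blast
      also have "wl (list_prod w) \<le> m * lY"
        using wl_list_prod_le[of w Y lY] w(1) Y(1) lY by (simp add: L_def)
      also have "wl (list_prod x) \<le> (m * k) * lF"
        using wl_list_prod_le[of x F lF] ax(2) F(1) lF by (simp add: T_def)
      finally have "wl a \<le> m * lY + wl a0 + (m * k) * lF" by simp
      also have "\<dots> \<le> R * Suc m" by (simp add: R_def algebra_simps)
      finally have "a \<in> B" using ax(1) aG by (simp add: B_def word_ball_eq)
      then show "z \<in> (\<lambda>(a, x). a \<otimes> list_prod x) ` (B \<times> T)" using ax by force
    qed
    then have "card (\<phi> ` L) \<le> card (B \<times> T)"
      using finB finT by (meson card_image_le card_mono finite_SigmaI finite_imageI le_trans)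
    moreover have "card T = (card F ^ k) ^ m"
      unfolding T_def card_lists_length_eq[OF F(2)] by (simp add: power_mult mult.commute)
    ultimately have "2 ^ m * (card F ^ k) ^ m \<le> card B * (card F ^ k) ^ m"
      by (simp add: card_cartesian_product power_mult_distrib)
    then show "2 ^ m \<le> card B" using cF by simp
  qed
  moreover have "0 < R" by (simp add: R_def)
  ultimately show ?thesis using positive_growthI by blast
qed

end

section \<open>The dichotomy\<close>

theorem theorem1p1:
  fixes G :: "('a, 'b) monoid_scheme" and S A :: "'a set"
  assumes "hyperbolic_group G"
    and "finite_generating_set G S"
    and "approximate_semigroup G A"
    and "infinite A"
  shows "positive_exponential_growth G S A \<or> virtually_cyclic (G\<lparr>carrier := generate G A\<rparr>)"
proof (cases "virtually_cyclic (G\<lparr>carrier := generate G A\<rparr>)")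
  case False
  interpret group G using assms(1) by (simp add: hyperbolic_group_def)
  obtain S' where S': "finite_generating_set G S'" "gromov_hyperbolic (carrier G) (word_dist G S')"
    using assms(1) by (auto simp: hyperbolic_group_def)
  interpret W': word_metric G S' by unfold_locales (rule S'(1))
  interpret W: word_metric G S by unfold_locales (rule assms(2))
  obtain \<delta> where "hyperbolic_length G (\<lambda>x. real (word_length G S' x)) \<delta>"
    using W'.gromov_hyperbolic_imp_hyperbolic_length[OF S'(2)] by blast
  then interpret H: hyperbolic_length G "\<lambda>x. real (word_length G S' x)" \<delta> .
  obtain F0 where F0: "finite F0" "F0 \<subseteq> carrier G" "A <#>\<^bsub>G\<^esub> A \<subseteq> A <#>\<^bsub>G\<^esub> F0" and A: "A \<subseteq> carrier G"
    using assms(3) by (auto simp: approximate_semigroup_def)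
  \<comment> \<open>The identity is added to F so that the sets A F^i increase with i.\<close>
  define F where "F = insert \<one>\<^bsub>G\<^esub> F0"
  have F: "F \<subseteq> carrier G" "finite F" "\<one>\<^bsub>G\<^esub> \<in> F" using F0 by (auto simp: F_def)
  have "A <#>\<^bsub>G\<^esub> F0 \<subseteq> A <#>\<^bsub>G\<^esub> F" by (auto simp: F_def set_mult_def)
  then have AF: "A <#>\<^bsub>G\<^esub> A \<subseteq> A <#>\<^bsub>G\<^esub> F" using F0(3) by blast
  define P where "P = {y \<in> generate G A. \<exists>k. absorbs A F k y}"
  have PG: "P \<subseteq> carrier G" using generate_in_carrier[OF A] by (auto simp: P_def)
  have P: "subsemigroup P"
    unfolding subsemigroup_def
  proof (intro conjI ballI)
    fix y z assume "y \<in> P" "z \<in> P"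
    then show "y \<otimes>\<^bsub>G\<^esub> z \<in> P"
      using absorbs_mult[OF A F(1)] PG unfolding P_def by (blast intro: generate.eng)
  qed (rule PG)
  have AP: "A \<subseteq> P" using absorbs_self[OF A F(1) AF] by (auto simp: P_def intro: generate.incl)
  have "generate G P = generate G A"
  proof
    show "generate G A \<subseteq> generate G P" using mono_generate[OF AP] .
    show "generate G P \<subseteq> generate G A"
      using generate_subgroup_incl[OF _ generate_is_subgroup[OF A]] by (auto simp: P_def)
  qed
  then have "\<not> virtually_cyclic (G\<lparr>carrier := generate G P\<rparr>)" using False by simp
  then obtain \<Gamma> where \<Gamma>: "finite \<Gamma>" "\<Gamma> \<subseteq> P"
    and free: "\<And>M. \<exists>Y. finite Y \<and> card Y = M \<and> Y \<subseteq> {a \<otimes>\<^bsub>G\<^esub> g |a g. a \<in> A \<and> g \<in> \<Gamma>} \<and> free_on Y"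
    using H.free_or_virtually_cyclic[OF P assms(4) AP] by blast
  have "\<forall>g\<in>\<Gamma>. \<exists>k. absorbs A F k g" using \<Gamma> by (auto simp: P_def)
  then obtain \<kappa> where \<kappa>: "\<And>g. g \<in> \<Gamma> \<Longrightarrow> absorbs A F (\<kappa> g) g" by metis
  define k where "k = Max (insert 0 (\<kappa> ` \<Gamma>))"
  have k: "absorbs A F k g" if "g \<in> \<Gamma>" for g
  proof (rule absorbs_mono[OF F(1,3) _ \<kappa>[OF that]])
    show "\<kappa> g \<le> k" unfolding k_def using \<Gamma>(1) that by (intro Max_ge) auto
  qed
  obtain Y where Y: "finite Y" "card Y = 2 * card F ^ (1 + k)"
    "Y \<subseteq> {a \<otimes>\<^bsub>G\<^esub> g |a g. a \<in> A \<and> g \<in> \<Gamma>}" "free_on Y"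
    using free by blast
  have Y': "y \<in> carrier G \<and> absorbs A F (1 + k) y" if "y \<in> Y" for y
  proof -
    obtain a g where ag: "a \<in> A" "g \<in> \<Gamma>" "y = a \<otimes>\<^bsub>G\<^esub> g" using Y(3) \<open>y \<in> Y\<close> by blast
    have "a \<in> carrier G" "g \<in> carrier G" using ag A \<Gamma>(2) PG by auto
    then show ?thesis
      using absorbs_mult[OF A F(1) _ _ absorbs_self[OF A F(1) AF ag(1)] k[OF ag(2)]] ag(3) by simp
  qed
  obtain a0 where "a0 \<in> A" using assms(4) by (metis ex_in_conv finite.emptyI)
  then have "positive_exponential_growth G S A"
    using W.positive_growth_of_free[OF A F _ Y(1,2) _ Y(4)] Y' by blast
  then show ?thesis by blast
qed simp

end
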